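(* Let $X$ be a sequentially complete Hausdorff locally convex space such that $X_{\mathrm{b}}'$ is sequentially complete, and let $(T(t))_{t\geq 0}$ be a strongly continuous locally equicontinuous semigroup on $X$ with generator $(A,D(A))$ such that $\rho_{\mathrm{alg}}(A)\neq\varnothing$. Then \[ \sigma_{\mathrm{r}}(T(t))\setminus\{0\}=\mathrm{e}^{t\sigma_{\mathrm{r}}(A)} \] holds for all $t\geq 0$.
   Context: All locally convex spaces have scalar field $\mathbb{C}$. $\Gamma_X$ denotes a fundamental system of seminorms inducing the topology of $X$ (every continuous seminorm is bounded by a constant multiple of a member of $\Gamma_X$), and $\mathcal{L}(X)$ the space of continuous linear operators $X\to X$. $X_{\mathrm{b}}'$ is the topological dual $X'$ equipped with the topology $\beta(X',X)$ of uniform convergence on bounded subsets of $X$. A semigroup on $X$ is a family $(T(t))_{t\geq 0}$ in $\mathcal{L}(X)$ with $T(0)=\mathrm{id}$ and $T(t+s)=T(t)T(s)$ for all $t,s\geq 0$. It is strongly continuous if $t\mapsto T(t)x$ is continuous $[0,\infty)\to X$ for every $x\in X$. It is locally equicontinuous if for all $q\in\Gamma_X$ and $t_0\geq 0$ there are $p\in\Gamma_X$, $C\geq 0$ with $q(T(t)x)\leq Cp(x)$ for all $t\in[0,t_0]$, $x\in X$. The generator $(A,D(A))$ is given by $Ax=\lim_{t\to 0+}\frac{T(t)x-x}{t}$ with $D(A)$ the set of all $x\in X$ for which this limit exists in $X$. For a linear operator $(B,D(B))$ on $X$: the algebraic resolvent set is $\rho_{\mathrm{alg}}(B):=\{\lambda\in\mathbb{C}\mid\lambda-B\colon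 D(B)\to X\text{ is bijective}\}$, and the residual spectrum is $\sigma_{\mathrm{r}}(B):=\{\lambda\in\mathbb{C}\mid\operatorname{ran}(\lambda-B)\text{ is not dense in }X\}$, where $\operatorname{ran}(\lambda-B)=\{(\lambda-B)x\mid x\in D(B)\}$. For $M\subseteq\mathbb{C}$, $\mathrm{e}^{tM}:=\{\mathrm{e}^{t\lambda}\mid\lambda\in M\}$.
   Formalization: At t = 0 the identity is claimed only if σ_r(A) is non-empty or X = {0}; otherwise it fails, since σ_r(id) = {1} while e^{0·∅} = ∅ (e.g. multiplication by e^{itx} on L²(ℝ)). *)

theory Defs
  imports "HOL-Analysis.Analysis"
begin

text \<open>A locally convex space over \<open>\<complex>\<close> consists of a type carrying an additive group and a topology,
  a scalar multiplication \<open>smul\<close>, and a fundamental system \<open>\<Gamma>\<close> of seminorms. The vector space and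
  its linear maps are those of \<^theory>\<open>HOL.Vector_Spaces\<close>; in particular
  \<^term>\<open>Vector_Spaces.linear\<close> with \<^term>\<open>(*) :: complex \<Rightarrow> complex \<Rightarrow> complex\<close> on the right
  describes linear functionals. Given \<open>induces_topology\<close> below, the class \<^class>\<open>topological_ab_group_add\<close>
  restricts nothing; \<^class>\<open>t2_space\<close> expresses that the space is Hausdorff.\<close>

definition seminorm :: "(complex \<Rightarrow> 'a \<Rightarrow> 'a) \<Rightarrow> ('a::ab_group_add \<Rightarrow> real) \<Rightarrow> bool" where
  "seminorm smul p \<longleftrightarrow>
     (\<forall>x. 0 \<le> p x) \<and>
     (\<forall>x y. p (x + y) \<le> p x + p y) \<and>
     (\<forall>c x. p (smul c x) = cmod c * p x)"

definition induces_topology :: "('a::{ab_group_add,topological_space} \<Rightarrow> real) set \<Rightarrow> bool" where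
  "induces_topology \<Gamma> \<longleftrightarrow>
     (\<forall>U. open U \<longleftrightarrow>
        (\<forall>x\<in>U. \<exists>F e. finite F \<and> F \<subseteq> \<Gamma> \<and> 0 < e \<and> {y. \<forall>p\<in>F. p (y - x) < e} \<subseteq> U))"

definition fundamental_system ::
    "(complex \<Rightarrow> 'a \<Rightarrow> 'a) \<Rightarrow> ('a::{ab_group_add,topological_space} \<Rightarrow> real) set \<Rightarrow> bool" where
  "fundamental_system smul \<Gamma> \<longleftrightarrow>
     (\<forall>p\<in>\<Gamma>. seminorm smul p) \<and>
     induces_topology \<Gamma> \<and>
     (\<forall>q. seminorm smul q \<and> continuous_on UNIV q \<longrightarrow> (\<exists>p\<in>\<Gamma>. \<exists>C\<ge>0. \<forall>x. q x \<le> C * p x))"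

definition locally_convex_space ::
    "(complex \<Rightarrow> 'a \<Rightarrow> 'a) \<Rightarrow> ('a::{ab_group_add,topological_space} \<Rightarrow> real) set \<Rightarrow> bool" where
  "locally_convex_space smul \<Gamma> \<longleftrightarrow> vector_space smul \<and> fundamental_system smul \<Gamma>"

text \<open>Sequential completeness is defined relative to a carrier \<open>S\<close> and a family \<open>P\<close> of seminorms
  generating its topology, so that it applies both to the space itself and to its strong dual,
  whose elements are functions and whose topology is not that of a type class.\<close>

definition seq_complete_on :: "'b set \<Rightarrow> ('b::minus \<Rightarrow> real) set \<Rightarrow> bool" where
  "seq_complete_on S P \<longleftrightarrow>
     (\<forall>u :: nat \<Rightarrow> 'b.
        range u \<subseteq> S \<and> (\<forall>p\<in>P. \<forall>e>0. \<exists>N. \<forall>m\<ge>N. \<forall>n\<ge>N. p (u m - u n) < e) \<longrightarrow>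
        (\<exists>l\<in>S. \<forall>p\<in>P. (\<lambda>n. p (u n - l)) \<longlonglongrightarrow> 0))"

definition top_dual ::
    "(complex \<Rightarrow> 'a \<Rightarrow> 'a) \<Rightarrow> ('a::{ab_group_add,topological_space} \<Rightarrow> complex) set" where
  "top_dual smul = {f. Vector_Spaces.linear smul (*) f \<and> continuous_on UNIV f}"

definition lc_bounded :: "('a \<Rightarrow> real) set \<Rightarrow> 'a set \<Rightarrow> bool" where
  "lc_bounded \<Gamma> B \<longleftrightarrow> (\<forall>p\<in>\<Gamma>. bdd_above (p ` B))"

text \<open>The seminorms generating \<open>\<beta>(X', X)\<close>. The empty set is excluded because the supremum of the
  empty set of reals is unspecified.\<close>

definition strong_dual_seminorms :: "('a \<Rightarrow> real) set \<Rightarrow> (('a \<Rightarrow> complex) \<Rightarrow> real) set" where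
  "strong_dual_seminorms \<Gamma> = {(\<lambda>f. SUP x\<in>B. cmod (f x)) | B. lc_bounded \<Gamma> B \<and> B \<noteq> {}}"

definition continuous_linear_operators ::
    "(complex \<Rightarrow> 'a \<Rightarrow> 'a) \<Rightarrow> ('a::{ab_group_add,topological_space} \<Rightarrow> 'a) set" where
  "continuous_linear_operators smul =
     {S. Vector_Spaces.linear smul smul S \<and> continuous_on UNIV S}"

text \<open>A semigroup is a function on all of \<open>\<real>\<close>, of which only the values on \<open>[0,\<infinity>)\<close> matter.\<close>

definition operator_semigroup ::
    "(complex \<Rightarrow> 'a \<Rightarrow> 'a) \<Rightarrow> (real \<Rightarrow> 'a \<Rightarrow> 'a::{ab_group_add,topological_space}) \<Rightarrow> bool" where
  "operator_semigroup smul T \<longleftrightarrow>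
     (\<forall>t\<ge>0. T t \<in> continuous_linear_operators smul) \<and>
     T 0 = id \<and>
     (\<forall>t\<ge>0. \<forall>s\<ge>0. T (t + s) = T t \<circ> T s)"

definition strongly_continuous :: "(real \<Rightarrow> 'a \<Rightarrow> 'a::topological_space) \<Rightarrow> bool" where
  "strongly_continuous T \<longleftrightarrow> (\<forall>x. continuous_on {0..} (\<lambda>t. T t x))"

definition locally_equicontinuous :: "('a \<Rightarrow> real) set \<Rightarrow> (real \<Rightarrow> 'a \<Rightarrow> 'a) \<Rightarrow> bool" where
  "locally_equicontinuous \<Gamma> T \<longleftrightarrow>
     (\<forall>q\<in>\<Gamma>. \<forall>t0\<ge>0. \<exists>p\<in>\<Gamma>. \<exists>C\<ge>0. \<forall>t\<in>{0..t0}. \<forall>x. q (T t x) \<le> C * p x)"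

definition generator_domain ::
    "(complex \<Rightarrow> 'a \<Rightarrow> 'a) \<Rightarrow> (real \<Rightarrow> 'a \<Rightarrow> 'a::{ab_group_add,t2_space}) \<Rightarrow> 'a set" where
  "generator_domain smul T =
     {x. \<exists>y. ((\<lambda>t. smul (complex_of_real (1 / t)) (T t x - x)) \<longlongrightarrow> y) (at_right 0)}"

text \<open>Only meaningful on \<open>generator_domain smul T\<close>.\<close>

definition generator ::
    "(complex \<Rightarrow> 'a \<Rightarrow> 'a) \<Rightarrow> (real \<Rightarrow> 'a \<Rightarrow> 'a) \<Rightarrow> 'a \<Rightarrow> 'a::{ab_group_add,t2_space}" where
  "generator smul T x =
     Lim (at_right 0) (\<lambda>t. smul (complex_of_real (1 / t)) (T t x - x))"

text \<open>A linear operator \<open>(B, D(B))\<close> is given as a function \<open>B\<close> together with its domain \<open>D\<close>;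
  for an everywhere defined operator \<open>D\<close> is \<^term>\<open>UNIV\<close>.\<close>

definition alg_resolvent_set ::
    "(complex \<Rightarrow> 'a \<Rightarrow> 'a) \<Rightarrow> 'a set \<Rightarrow> ('a \<Rightarrow> 'a::ab_group_add) \<Rightarrow> complex set" where
  "alg_resolvent_set smul D B = {\<mu>. bij_betw (\<lambda>x. smul \<mu> x - B x) D UNIV}"

definition residual_spectrum ::
    "(complex \<Rightarrow> 'a \<Rightarrow> 'a) \<Rightarrow> 'a set \<Rightarrow> ('a \<Rightarrow> 'a::{ab_group_add,topological_space}) \<Rightarrow> complex set" where
  "residual_spectrum smul D B = {\<mu>. closure ((\<lambda>x. smul \<mu> x - B x) ` D) \<noteq> UNIV}"

text \<open>At \<open>t = 0\<close> the residual spectrum of \<open>T 0 = id\<close> is \<open>{1}\<close> for \<open>X \<noteq> {0}\<close>, whereas the image of the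
  residual spectrum of the generator under \<open>\<mu> \<mapsto> exp (0 * \<mu>)\<close> is empty if that spectrum is empty (as
  for the multiplication semigroup \<open>f \<mapsto> exp (\<i> * t * x) * f\<close> on \<open>L\<^sup>2(\<real>)\<close>). Hence the spectral mapping
  identity can be stated at \<open>t = 0\<close> only for \<open>X = {0}\<close> or nonempty residual spectrum of the
  generator.\<close>

end

theory Submission
  imports Defs
begin

text \<open>By the Hahn--Banach theorem a number \<open>\<mu>\<close> belongs to the residual spectrum of a linear operator
  \<open>B\<close> iff it has an eigenfunctional for \<open>\<mu>\<close>: a nonzero continuous linear functional \<open>f\<close> that satisfies
  \<open>f (B x) = \<mu> * f x\<close> on the domain of \<open>B\<close> (\<open>residual_spectrum_iff_eigenfunctional\<close>). So the
  theorem compares eigenfunctionals of the generator \<open>A\<close> with eigenfunctionals of \<open>T t\<close>, and only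
  scalar functions \<open>s \<mapsto> f (T s x)\<close> have to be differentiated and integrated.

  If \<open>f\<close> is an eigenfunctional of \<open>A\<close> for \<open>\<mu>\<close>, let \<open>y\<close> be the integral of the orbit of \<open>x\<close> over \<open>[0, h]\<close>,
  which exists in \<open>X\<close> as a limit of Riemann sums (\<open>weak_integral_exists\<close>). It lies in the domain and
  \<open>A y = T h x - x\<close> (\<open>orbit_integral_generator\<close>). Applying \<open>f\<close> turns this into the integral form of the
  differential equation \<open>\<phi>' = \<mu> \<phi>\<close> for \<open>\<phi> h = f (T h x)\<close>, whence \<open>f (T h x) = exp (h \<mu>) f x\<close>
  (\<open>eigenfunctional_orbit\<close>).

  Conversely let \<open>f (T t x) = z * f x\<close> with \<open>z \<noteq> 0\<close> and \<open>t > 0\<close>. For each of the countably many \<open>\<mu>\<close> with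
  \<open>exp (t \<mu>) = z\<close> the function \<open>s \<mapsto> exp (- s \<mu>) f (T s x)\<close> has period \<open>t\<close>, so its integral over one
  period, as a function of \<open>x\<close>, is a functional \<open>g\<close> with \<open>g (T r x) = exp (r \<mu>) g x\<close> for all \<open>r\<close>;
  differentiation at \<open>r = 0\<close> gives \<open>g (A x) = \<mu> * g x\<close>. Local equicontinuity makes \<open>g\<close> continuous. For fixed
  \<open>x\<close> these integrals are, up to a constant factor, the Fourier coefficients of a single continuous periodic
  function whose value at \<open>0\<close> is \<open>f x\<close>. If \<open>f x \<noteq> 0\<close>, they cannot all vanish (\<open>fourier_null_endpoints\<close>); so
  some \<open>g\<close> is nonzero, and its \<open>\<mu>\<close> lies in the residual spectrum of \<open>A\<close>.

  For \<open>t = 0\<close> both sides are empty if \<open>X = {0}\<close>; otherwise the residual spectrum of \<open>A\<close> is nonempty by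
  assumption, and both sides are \<open>{1}\<close>.\<close>

section \<open>Minimal sublinear functionals and the Hahn--Banach theorem\<close>

definition sublinear :: "(real \<Rightarrow> 'a \<Rightarrow> 'a) \<Rightarrow> ('a::ab_group_add \<Rightarrow> real) \<Rightarrow> bool" where
  "sublinear rsmul p \<longleftrightarrow>
     (\<forall>x y. p (x + y) \<le> p x + p y) \<and> (\<forall>r\<ge>0. \<forall>x. p (rsmul r x) = r * p x)"

locale real_vs = vector_space scale for scale :: "real \<Rightarrow> 'a::ab_group_add \<Rightarrow> 'a"
begin

lemma sublinear_add: "sublinear scale p \<Longrightarrow> p (x + y) \<le> p x + p y"
  by (simp add: sublinear_def)

lemma sublinear_scale: "sublinear scale p \<Longrightarrow> 0 \<le> r \<Longrightarrow> p (scale r x) = r * p x"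
  by (simp add: sublinear_def)

lemma sublinear_zero: "sublinear scale p \<Longrightarrow> p 0 = 0"
  using sublinear_scale[of p 0 0] by simp

lemma sublinear_minus: "sublinear scale p \<Longrightarrow> - p (- x) \<le> p x"
  using sublinear_add[of p x "- x"] sublinear_zero[of p] by simp

text \<open>The index \<open>k\<close> may depend on the points as well as on the given indices. In this generality the lemma
  covers three infima: that of a chain of sublinear functionals, the descent step towards a minimal
  one, and the quotient seminorm modulo a subspace. Positive homogeneity needs only one inequality,
  because the other one follows by scaling back.\<close>
lemma sublinear_INF:
  fixes a :: "'i \<Rightarrow> 'a \<Rightarrow> real"
  assumes I: "I \<noteq> {}"
    and bdd: "\<And>x. bdd_below ((\<lambda>i. a i x) ` I)"
    and add: "\<And>i j x y. i \<in> I \<Longrightarrow> j \<in> I \<Longrightarrow> \<exists>k\<in>I. a k (x + y) \<le> a i x + a j y"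
    and scl: "\<And>i r x. i \<in> I \<Longrightarrow> 0 < r \<Longrightarrow> \<exists>k\<in>I. a k (scale r x) \<le> r * a i x"
  shows "sublinear scale (\<lambda>x. INF i\<in>I. a i x)"
proof -
  define q where "q = (\<lambda>x. INF i\<in>I. a i x)"
  have q_le: "q x \<le> a i x" if "i \<in> I" for i x
    unfolding q_def using bdd that by (rule cINF_lower)
  have q_ge: "c \<le> q x" if "\<And>i. i \<in> I \<Longrightarrow> c \<le> a i x" for c x
    unfolding q_def using I that by (rule cINF_greatest)
  have q_add: "q (x + y) \<le> q x + q y" for x y
  proof -
    have *: "q (x + y) - a j y \<le> q x" if j: "j \<in> I" for j
    proof (rule q_ge)
      fix i assume "i \<in> I"
      then obtain k where "k \<in> I" "a k (x + y) \<le> a i x + a j y"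
        using add j by blast
      then show "q (x + y) - a j y \<le> a i x"
        using q_le[of k "x + y"] by linarith
    qed
    have "q (x + y) - q x \<le> q y"
    proof (rule q_ge)
      fix j assume "j \<in> I"
      then show "q (x + y) - q x \<le> a j y" using *[of j] by linarith
    qed
    then show ?thesis by linarith
  qed
  have q_scl: "q (scale r x) \<le> r * q x" if r: "0 < r" for r x
  proof -
    have "q (scale r x) / r \<le> q x"
    proof (rule q_ge)
      fix i assume "i \<in> I"
      then obtain k where "k \<in> I" "a k (scale r x) \<le> r * a i x"
        using scl r by blast
      then have "q (scale r x) \<le> r * a i x"
        using q_le[of k "scale r x"] by linarith
      then show "q (scale r x) / r \<le> a i x"
        using r by (simp add: field_simps)
    qed
    then show ?thesis using r by (simp add: field_simps)
  qed
  have q0: "q 0 = 0"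
    using q_add[of 0 0] q_scl[of "1/2" 0] by simp
  have "q (scale r x) = r * q x" if r: "0 \<le> r" for r x
  proof (cases "r = 0")
    case True
    then show ?thesis using q0 by simp
  next
    case False
    then have "0 < r" using r by simp
    then have "q x \<le> inverse r * q (scale r x)"
      using q_scl[of "inverse r" "scale r x"] by simp
    then have "r * q x \<le> q (scale r x)"
      using \<open>0 < r\<close> by (simp add: field_simps)
    then show ?thesis using q_scl[OF \<open>0 < r\<close>, of x] by linarith
  qed
  then show ?thesis using q_add unfolding sublinear_def q_def by blast
qed

text \<open>The infimum over \<open>t \<ge> 0\<close> of \<open>p (x + t y) - t * p y\<close> is sublinear; the values \<open>t = 0\<close> and \<open>t = 1\<close> give
  the two bounds. It lowers \<open>p\<close> strictly unless \<open>p (x + y) = p x + p y\<close> for all \<open>x\<close>.\<close>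
lemma sublinear_descent:
  assumes p: "sublinear scale p"
  shows "\<exists>p'. sublinear scale p' \<and> p' \<le> p \<and> (\<forall>x. p' x \<le> p (x + y) - p y)"
proof -
  define a where "a = (\<lambda>t x. p (x + scale t y) - t * p y)"
  define p' where "p' = (\<lambda>x. INF t\<in>{0..}. a t x)"
  have bdd: "bdd_below ((\<lambda>t. a t x) ` {0..})" for x
  proof (rule bdd_belowI2)
    fix t :: real assume "t \<in> {0..}"
    then have "t * p y = p ((x + scale t y) + (- x))"
      using sublinear_scale[OF p, of t y] by simp
    also have "\<dots> \<le> p (x + scale t y) + p (- x)" by (rule sublinear_add[OF p])
    finally show "- p (- x) \<le> a t x" unfolding a_def by linarith
  qed
  have "sublinear scale p'" unfolding p'_def
  proof (rule sublinear_INF[OF _ bdd])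
    fix t s :: real and x z assume "t \<in> {0..}" "s \<in> {0..}"
    moreover have "a (t + s) (x + z) \<le> a t x + a s z"
      using sublinear_add[OF p, of "x + scale t y" "z + scale s y"]
      unfolding a_def by (simp add: algebra_simps)
    ultimately show "\<exists>k\<in>{0..}. a k (x + z) \<le> a t x + a s z"
      by (intro bexI[of _ "t + s"]) auto
  next
    fix t r :: real and x assume t: "t \<in> {0..}" and r: "0 < r"
    have "a (r * t) (scale r x) \<le> r * a t x"
      using sublinear_scale[OF p, of r "x + scale t y"] r
      unfolding a_def by (simp add: algebra_simps)
    then show "\<exists>k\<in>{0..}. a k (scale r x) \<le> r * a t x"
      using t r by (intro bexI[of _ "r * t"]) auto
  qed simp
  moreover have le: "p' x \<le> a t x" if "0 \<le> t" for t x
    unfolding p'_def using bdd by (rule cINF_lower) (use that in simp)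
  have "p' \<le> p"
    using le[of 0] by (auto simp: le_fun_def a_def)
  moreover have "p' x \<le> p (x + y) - p y" for x
    using le[of 1 x] by (simp add: a_def)
  ultimately show ?thesis by blast
qed

text \<open>Descending from a minimal \<open>m\<close> in direction \<open>y\<close> cannot lower it, and the second bound of
  \<open>sublinear_descent\<close> then says that \<open>m\<close> is superadditive.\<close>
lemma minimal_sublinear_linear:
  assumes m: "sublinear scale m"
    and min: "\<And>p. sublinear scale p \<Longrightarrow> p \<le> m \<Longrightarrow> p = m"
  shows "m (x + y) = m x + m y" and "m (scale r x) = r * m x"
proof -
  have add: "m (x + y) = m x + m y" for x y
  proof -
    obtain p where "sublinear scale p" "p \<le> m" "\<And>x. p x \<le> m (x + y) - m y"
      using sublinear_descent[OF m] by blast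
    with min[of p] have "m x \<le> m (x + y) - m y" by blast
    then show ?thesis using sublinear_add[OF m, of x y] by linarith
  qed
  then show "m (x + y) = m x + m y" .
  have neg: "m (- x) = - m x" for x
    using add[of x "- x"] sublinear_zero[OF m] by simp
  show "m (scale r x) = r * m x"
  proof (cases "0 \<le> r")
    case False
    then have "m (scale (- r) x) = - r * m x" by (intro sublinear_scale[OF m]) simp
    then show ?thesis using neg[of "scale r x"] by simp
  qed (rule sublinear_scale[OF m])
qed

lemma exists_minimal_sublinear:
  assumes d: "sublinear scale d"
  shows "\<exists>m. sublinear scale m \<and> m \<le> d \<and> (\<forall>p. sublinear scale p \<longrightarrow> p \<le> m \<longrightarrow> p = m)"
proof -
  define A where "A = {p. sublinear scale p \<and> p \<le> d}"
  have po: "partial_order_on A (relation_of (\<lambda>p q. q \<le> p) A)"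
    by (rule partial_order_on_relation_ofI) auto
  have "\<exists>m\<in>A. \<forall>p\<in>A. p \<le> m \<longrightarrow> p = m"
  proof (rule predicate_Zorn[OF po])
    fix C assume "C \<in> Chains (relation_of (\<lambda>p q. q \<le> p) A)"
    then have C: "C \<subseteq> A" and chain: "\<And>p q. p \<in> C \<Longrightarrow> q \<in> C \<Longrightarrow> p \<le> q \<or> q \<le> p"
      by (auto simp: Chains_def relation_of_def)
    show "\<exists>u\<in>A. \<forall>p\<in>C. u \<le> p"
    proof (cases "C = {}")
      case True
      then show ?thesis using d by (auto simp: A_def)
    next
      case False
      have bdd: "bdd_below ((\<lambda>p. p x) ` C)" for x
      proof (rule bdd_belowI2)
        fix p assume "p \<in> C"
        then have "sublinear scale p" "p (- x) \<le> d (- x)" using C by (auto simp: A_def le_fun_def)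
        then show "- d (- x) \<le> p x" using sublinear_minus[of p x] by linarith
      qed
      define u where "u = (\<lambda>x. INF p\<in>C. p x)"
      have u_le: "u x \<le> p x" if "p \<in> C" for p x
        unfolding u_def using bdd that by (rule cINF_lower)
      have "sublinear scale u" unfolding u_def
      proof (rule sublinear_INF[OF False bdd])
        fix p q x y assume pq: "p \<in> C" "q \<in> C"
        have le: "r (x + y) \<le> r x + r y" if "r \<in> C" for r
          using that C by (auto simp: A_def intro: sublinear_add)
        show "\<exists>k\<in>C. k (x + y) \<le> p x + q y"
          using chain[OF pq]
        proof
          assume "p \<le> q"
          then have "p y \<le> q y" by (simp add: le_fun_def)
          then show ?thesis using le[OF pq(1)] pq(1) by (intro bexI[of _ p]) auto
        next
          assume "q \<le> p"
          then have "q x \<le> p x" by (simp add: le_fun_def)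
          then show ?thesis using le[OF pq(2)] pq(2) by (intro bexI[of _ q]) auto
        qed
      next
        fix p x and r :: real assume p: "p \<in> C" and "0 < r"
        then have "p (scale r x) = r * p x"
          using C by (intro sublinear_scale) (auto simp: A_def)
        then show "\<exists>k\<in>C. k (scale r x) \<le> r * p x" using p by (intro bexI[of _ p]) auto
      qed
      moreover have "u \<le> d"
      proof (rule le_funI)
        fix x
        obtain p where "p \<in> C" using False by blast
        moreover have "p x \<le> d x" using \<open>p \<in> C\<close> C by (auto simp: A_def le_fun_def)
        ultimately show "u x \<le> d x" using u_le[of p x] by linarith
      qed
      ultimately show ?thesis using u_le by (intro bexI[of _ u]) (auto simp: A_def le_fun_def)
    qed
  qed
  then show ?thesis unfolding A_def by (auto intro: order_trans)
qed

text \<open>The linear functional is a minimal sublinear functional, so that no partially defined functional has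
  to be extended. One descent in direction \<open>y\<close> beforehand pushes the value at \<open>- y\<close> down to \<open>- d y\<close>,
  which forces \<open>f y = d y\<close>.\<close>
theorem hahn_banach_sublinear:
  assumes d: "sublinear scale d"
  shows "\<exists>f. (\<forall>x y. f (x + y) = f x + f y) \<and> (\<forall>r x. f (scale r x) = r * f x) \<and>
             f \<le> d \<and> f y = d y"
proof -
  obtain p where p: "sublinear scale p" "p \<le> d" "\<And>x. p x \<le> d (x + y) - d y"
    using sublinear_descent[OF d] by blast
  obtain f where f: "sublinear scale f" "f \<le> p" "\<And>q. sublinear scale q \<Longrightarrow> q \<le> f \<Longrightarrow> q = f"
    using exists_minimal_sublinear[OF p(1)] by blast
  note lin = minimal_sublinear_linear[OF f(1) f(3)]
  have "f (- y) \<le> - d y"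
    using p(3)[of "- y"] f(2) sublinear_zero[OF d] by (auto simp: le_fun_def intro: order_trans)
  moreover have "f (- y) = - f y" using lin(2)[of "-1" y] by simp
  moreover have "f \<le> d" using f(2) p(2) by (rule order_trans)
  ultimately have "f y = d y" by (auto simp: le_fun_def intro: antisym)
  then show ?thesis using lin \<open>f \<le> d\<close> by blast
qed

end

section \<open>Seminorms and functionals on complex vector spaces\<close>

lemma real_vs_of_complex:
  assumes "vector_space (smul :: complex \<Rightarrow> 'a::ab_group_add \<Rightarrow> 'a)"
  shows "real_vs (\<lambda>r. smul (complex_of_real r))"
proof -
  interpret vector_space smul by fact
  show ?thesis
    by unfold_locales (simp_all add: algebra_simps)
qed

locale complex_vs = vector_space smul for smul :: "complex \<Rightarrow> 'a::ab_group_add \<Rightarrow> 'a"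
begin

lemma seminorm_nonneg: "seminorm smul p \<Longrightarrow> 0 \<le> p x"
  and seminorm_triangle: "seminorm smul p \<Longrightarrow> p (x + y) \<le> p x + p y"
  and seminorm_scale: "seminorm smul p \<Longrightarrow> p (smul c x) = cmod c * p x"
  by (simp_all add: seminorm_def)

lemma seminorm_zero: "seminorm smul p \<Longrightarrow> p 0 = 0"
  using seminorm_scale[of p 0 0] by simp

lemma seminorm_minus: "seminorm smul p \<Longrightarrow> p (- x) = p x"
  using seminorm_scale[of p "-1" x] by simp

lemma seminorm_minus_commute: "seminorm smul p \<Longrightarrow> p (x - y) = p (y - x)"
  using seminorm_minus[of p "x - y"] by simp

lemma seminorm_diff_abs: "seminorm smul p \<Longrightarrow> \<bar>p x - p y\<bar> \<le> p (x - y)"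
  using seminorm_triangle[of p "x - y" y] seminorm_triangle[of p "y - x" x]
    seminorm_minus_commute[of p x y] by (simp add: abs_le_iff)

lemma linear_functionalD:
  assumes "Vector_Spaces.linear smul ((*) :: complex \<Rightarrow> complex \<Rightarrow> complex) f"
  shows "f (x + y) = f x + f y" "f (smul c x) = c * f x" "f (x - y) = f x - f y"
    and "f (sum g S) = (\<Sum>i\<in>S. f (g i))"
proof -
  interpret f: Vector_Spaces.linear smul "(*)" f by fact
  show "f (x + y) = f x + f y" "f (smul c x) = c * f x" "f (x - y) = f x - f y"
       "f (sum g S) = (\<Sum>i\<in>S. f (g i))"
    by (rule f.add f.scale f.diff f.sum)+
qed

lemma linear_functionalI:
  assumes "\<And>x y. f (x + y) = f x + f y" "\<And>c x. f (smul c x) = c * f x"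
  shows "Vector_Spaces.linear smul ((*) :: complex \<Rightarrow> complex \<Rightarrow> complex) f"
proof -
  interpret c: vector_space "(*) :: complex \<Rightarrow> complex \<Rightarrow> complex"
    by unfold_locales (simp_all add: algebra_simps)
  show ?thesis using assms by unfold_locales auto
qed

text \<open>A real-linear functional \<open>g\<close> is the real part of the complex-linear \<open>x \<mapsto> g x - \<i> * g (\<i> x)\<close>. Turning
  \<open>x\<close> by a unimodular scalar makes the value of this functional real, so a bound on \<open>g\<close> bounds its modulus.\<close>
lemma complexify_functional:
  fixes g :: "'a \<Rightarrow> real"
  assumes p: "seminorm smul p"
    and add: "\<And>x y. g (x + y) = g x + g y"
    and scl: "\<And>r x. g (smul (complex_of_real r) x) = r * g x"
    and le: "\<And>x. g x \<le> p x"
  defines "f \<equiv> \<lambda>x. Complex (g x) (- g (smul \<i> x))"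
  shows "Vector_Spaces.linear smul (*) f" and "cmod (f x) \<le> p x"
proof -
  have f_add: "f (x + y) = f x + f y" for x y
    by (simp add: f_def add scale_right_distrib complex_eq_iff)
  have f_real: "f (smul (complex_of_real r) x) = r * f x" for r x
    using scl[of r x] scl[of r "smul \<i> x"]
    by (simp add: f_def complex_eq_iff mult.commute)
  have f_i: "f (smul \<i> x) = \<i> * f x" for x
    using scl[of "-1" x] by (simp add: f_def complex_eq_iff)
  have f_scl: "f (smul c x) = c * f x" for c x
  proof -
    have "smul c x = smul (complex_of_real (Re c)) x + smul (complex_of_real (Im c)) (smul \<i> x)"
      by (metis complex_eq mult.commute scale_left_distrib scale_scale)
    then have "f (smul c x) = Re c * f x + Im c * (\<i> * f x)"
      by (simp add: f_add f_real f_i del: scale_scale)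
    also have "\<dots> = c * f x" 
      by (subst (3) complex_eq[of c]) (simp add: algebra_simps)
    finally show ?thesis .
  qed
  show "Vector_Spaces.linear smul (*) f"
    using f_add f_scl by (rule linear_functionalI)
  show "cmod (f x) \<le> p x"
  proof (cases "f x = 0")
    case True
    then show ?thesis using seminorm_nonneg[OF p] by simp
  next
    case False
    \<comment> \<open>The rotation that makes \<open>f x\<close> nonnegative real.\<close>
    define c where "c = cnj (f x) / complex_of_real (cmod (f x))"
    have "cmod c = 1" using False by (simp add: c_def norm_divide)
    have "c * f x = complex_of_real (cmod (f x))"
      using False by (simp add: c_def complex_norm_square[symmetric] power2_eq_square mult.commute)
    then have "cmod (f x) = Re (f (smul c x))" by (simp add: f_scl)
    also have "\<dots> \<le> p (smul c x)" using le by (simp add: f_def)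
    also have "\<dots> = p x" using \<open>cmod c = 1\<close> by (simp add: seminorm_scale[OF p])
    finally show ?thesis .
  qed
qed

text \<open>A sublinear bound by the distance \<open>d\<close> to \<open>M\<close>, rather than by \<open>q\<close>, makes the functional nonpositive on
  the subspace \<open>M\<close>, hence zero there.\<close>
theorem hahn_banach_subspace:
  assumes q: "seminorm smul q"
    and M: "subspace M"
    and far: "\<And>m. m \<in> M \<Longrightarrow> e \<le> q (x0 - m)"
  shows "\<exists>f. Vector_Spaces.linear smul (*) f \<and> (\<forall>x. cmod (f x) \<le> q x) \<and>
             (\<forall>m\<in>M. f m = 0) \<and> e \<le> Re (f x0)"
proof -
  interpret R: real_vs "\<lambda>r. smul (complex_of_real r)"
    by (rule real_vs_of_complex) (rule vector_space_axioms)
  define d where "d = (\<lambda>x. INF m\<in>M. q (x - m))"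
  have bdd: "bdd_below ((\<lambda>m. q (x - m)) ` M)" for x
    by (rule bdd_belowI2[of _ 0]) (rule seminorm_nonneg[OF q])
  have M0: "M \<noteq> {}" using subspace_0[OF M] by blast
  have "sublinear (\<lambda>r. smul (complex_of_real r)) d" unfolding d_def
  proof (rule R.sublinear_INF[OF M0 bdd])
    fix m n x y assume "m \<in> M" "n \<in> M"
    then show "\<exists>k\<in>M. q (x + y - k) \<le> q (x - m) + q (y - n)"
      using subspace_add[OF M, of m n] seminorm_triangle[OF q, of "x - m" "y - n"]
      by (intro bexI[of _ "m + n"]) (simp_all add: algebra_simps)
  next
    fix m x and r :: real assume "m \<in> M" "0 < r"
    then show "\<exists>k\<in>M. q (smul (complex_of_real r) x - k) \<le> r * q (x - m)"
      using subspace_scale[OF M, of m "complex_of_real r"]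
        seminorm_scale[OF q, of "complex_of_real r" "x - m"]
      by (intro bexI[of _ "smul (complex_of_real r) m"]) (simp_all add: scale_right_diff_distrib)
  qed
  then obtain g where g: "\<And>x y. g (x + y) = g x + g y"
      "\<And>r x. g (smul (complex_of_real r) x) = r * g x" "g \<le> d" "g x0 = d x0"
    using R.hahn_banach_sublinear[of d x0] by blast
  have d_le: "d x \<le> q (x - m)" if "m \<in> M" for x m
    unfolding d_def using bdd that by (rule cINF_lower)
  have g_le: "g x \<le> q (x - m)" if "m \<in> M" for x m
    using g(3) d_le[OF that, of x] by (auto simp: le_fun_def intro: order_trans)
  have g_le_q: "g x \<le> q x" for x
    using g_le[OF subspace_0[OF M]] by simp
  have g_M: "g m = 0" if "m \<in> M" for m
  proof -
    have "g m \<le> 0" using g_le[OF that, of m] seminorm_zero[OF q] by simp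
    moreover have "g (- m) \<le> 0"
      using g_le[OF subspace_neg[OF M that], of "- m"] seminorm_zero[OF q] by simp
    moreover have "g (- m) = - g m" using g(2)[of "-1" m] by simp
    ultimately show ?thesis by simp
  qed
  have "e \<le> g x0" unfolding g(4) d_def
    using M0 far by (rule cINF_greatest)
  moreover note complexify_functional[OF q g(1,2) g_le_q]
  moreover have "Complex (g m) (- g (smul \<i> m)) = 0" if "m \<in> M" for m
    using g_M[OF that] g_M[OF subspace_scale[OF M that]] by (simp add: complex_eq_iff)
  ultimately show ?thesis
    by (intro exI[of _ "\<lambda>x. Complex (g x) (- g (smul \<i> x))"]) simp
qed

corollary norming_functional:
  assumes q: "seminorm smul q"
  shows "\<exists>f. Vector_Spaces.linear smul (*) f \<and> (\<forall>x. cmod (f x) \<le> q x) \<and> q x0 \<le> cmod (f x0)"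
proof -
  obtain f where "Vector_Spaces.linear smul (*) f" "\<forall>x. cmod (f x) \<le> q x" "q x0 \<le> Re (f x0)"
    using hahn_banach_subspace[OF q subspace_single_0, of "q x0" x0] by auto
  then show ?thesis using complex_Re_le_cmod order_trans by blast
qed

end

section \<open>Locally convex spaces and their duals\<close>

locale lcs = complex_vs smul
  for smul :: "complex \<Rightarrow> 'a::{topological_ab_group_add,t2_space} \<Rightarrow> 'a" +
  fixes \<Gamma> :: "('a \<Rightarrow> real) set"
  assumes fundamental: "fundamental_system smul \<Gamma>"
begin

lemma seminorm_mem: "p \<in> \<Gamma> \<Longrightarrow> seminorm smul p"
  using fundamental unfolding fundamental_system_def by blast

lemma open_iff: "open U \<longleftrightarrow>
        (\<forall>x\<in>U. \<exists>F e. finite F \<and> F \<subseteq> \<Gamma> \<and> 0 < e \<and> {y. \<forall>p\<in>F. p (y - x) < e} \<subseteq> U)"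
proof -
  have "induces_topology \<Gamma>"
    using fundamental unfolding fundamental_system_def by (elim conjE)
  then show ?thesis unfolding induces_topology_def by (rule spec)
qed

lemma open_contains_seminorm_ball:
  assumes "open U" "x \<in> U"
  obtains F e where "finite F" "F \<subseteq> \<Gamma>" "0 < e" "{y. \<forall>p\<in>F. p (y - x) < e} \<subseteq> U"
proof -
  have "\<exists>F e. finite F \<and> F \<subseteq> \<Gamma> \<and> 0 < e \<and> {y. \<forall>p\<in>F. p (y - x) < e} \<subseteq> U"
    by (rule bspec[OF open_iff[THEN iffD1, OF assms(1)] assms(2)])
  then show thesis using that by (elim exE conjE)
qed

lemma seminorm_dominated:
  assumes "seminorm smul q" "continuous_on UNIV q"
  shows "\<exists>p\<in>\<Gamma>. \<exists>C\<ge>0. \<forall>x. q x \<le> C * p x"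
  using fundamental assms unfolding fundamental_system_def by blast

lemma open_seminorm_ball:
  assumes p: "p \<in> \<Gamma>" shows "open {y. p (y - x) < e}"
proof (rule open_iff[THEN iffD2], rule ballI)
  fix y assume y: "y \<in> {y. p (y - x) < e}"
  have "p (z - x) < e" if "p (z - y) < e - p (y - x)" for z
    using seminorm_triangle[OF seminorm_mem[OF p], of "z - y" "y - x"] that by simp
  then show "\<exists>F d. finite F \<and> F \<subseteq> \<Gamma> \<and> 0 < d \<and> {z. \<forall>p\<in>F. p (z - y) < d} \<subseteq> {y. p (y - x) < e}"
    using y p by (intro exI[of _ "{p}"] exI[of _ "e - p (y - x)"]) auto
qed

lemma continuous_mem:
  assumes p: "p \<in> \<Gamma>" shows "continuous_on UNIV p"
  unfolding continuous_on_def
proof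
  fix x
  show "(p \<longlongrightarrow> p x) (at x within UNIV)"
  proof (rule tendstoI)
    fix e :: real assume e: "0 < e"
    have "eventually (\<lambda>y. p (y - x) < e) (nhds x)"
      unfolding eventually_nhds
      using open_seminorm_ball[OF p, of x e] e seminorm_zero[OF seminorm_mem[OF p]]
      by (intro exI[of _ "{y. p (y - x) < e}"]) auto
    then have "eventually (\<lambda>y. dist (p y) (p x) < e) (nhds x)"
      by eventually_elim
        (use seminorm_diff_abs[OF seminorm_mem[OF p]] in \<open>auto simp: dist_real_def intro: le_less_trans\<close>)
    then show "eventually (\<lambda>y. dist (p y) (p x) < e) (at x within UNIV)"
      unfolding eventually_at_filter by eventually_elim simp
  qed
qed

lemma continuous_seminorm_diff_tendsto:
  assumes q: "seminorm smul q" "continuous_on UNIV q" and u: "(u \<longlongrightarrow> l) F"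
  shows "((\<lambda>i. q (u i - l)) \<longlongrightarrow> 0) F"
proof -
  have "((\<lambda>i. u i - l) \<longlongrightarrow> l - l) F" by (intro tendsto_intros u)
  then have "((\<lambda>i. q (u i - l)) \<longlongrightarrow> q (l - l)) F"
    by (rule continuous_on_tendsto_compose[OF q(2)]) auto
  then show ?thesis by (simp add: seminorm_zero[OF q(1)])
qed

lemma tendsto_seminormsI:
  assumes "\<And>p. p \<in> \<Gamma> \<Longrightarrow> ((\<lambda>i. p (u i - l)) \<longlongrightarrow> 0) F"
  shows "(u \<longlongrightarrow> l) F"
proof (rule topological_tendstoI)
  fix S assume "open S" "l \<in> S"
  then obtain G e where G: "finite G" "G \<subseteq> \<Gamma>" "0 < e" "{y. \<forall>p\<in>G. p (y - l) < e} \<subseteq> S"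
    by (rule open_contains_seminorm_ball)
  have "eventually (\<lambda>i. \<forall>p\<in>G. p (u i - l) < e) F"
  proof (rule eventually_ball_finite[OF G(1)], rule ballI)
    fix p assume "p \<in> G"
    then show "eventually (\<lambda>i. p (u i - l) < e) F"
      using order_tendstoD(2)[OF assms \<open>0 < e\<close>] G(2) by blast
  qed
  then show "eventually (\<lambda>i. u i \<in> S) F"
    by eventually_elim (use G(4) in blast)
qed

lemma dual_add: "f \<in> top_dual smul \<Longrightarrow> f (x + y) = f x + f y"
  and dual_scale: "f \<in> top_dual smul \<Longrightarrow> f (smul c x) = c * f x"
  and dual_continuous: "f \<in> top_dual smul \<Longrightarrow> continuous_on UNIV f"
  and dual_diff: "f \<in> top_dual smul \<Longrightarrow> f (x - y) = f x - f y"
  and dual_sum: "f \<in> top_dual smul \<Longrightarrow> f (sum g S) = (\<Sum>i\<in>S. f (g i))"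
  by (simp_all add: top_dual_def linear_functionalD)

lemma dual_tendsto:
  assumes "f \<in> top_dual smul" "(u \<longlongrightarrow> l) F"
  shows "((\<lambda>i. f (u i)) \<longlongrightarrow> f l) F"
  by (rule continuous_on_tendsto_compose[OF dual_continuous[OF assms(1)] assms(2)]) auto

text \<open>The modulus of a continuous functional is itself a continuous seminorm.\<close>
lemma dual_bounded:
  assumes f: "f \<in> top_dual smul"
  shows "\<exists>p\<in>\<Gamma>. \<exists>C\<ge>0. \<forall>x. cmod (f x) \<le> C * p x"
proof (rule seminorm_dominated)
  show "seminorm smul (\<lambda>x. cmod (f x))"
    by (simp add: seminorm_def dual_add[OF f] dual_scale[OF f] norm_triangle_ineq norm_mult)
  show "continuous_on UNIV (\<lambda>x. cmod (f x))"
    by (intro continuous_intros dual_continuous f)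
qed

lemma dualI:
  assumes f: "Vector_Spaces.linear smul (*) f"
    and q: "seminorm smul q" "continuous_on UNIV q" and le: "\<And>x. cmod (f x) \<le> q x"
  shows "f \<in> top_dual smul"
proof -
  have "continuous_on UNIV f"
    unfolding continuous_on_def
  proof
    fix x
    have "((\<lambda>y. q (y - x)) \<longlongrightarrow> 0) (at x within UNIV)"
      by (rule continuous_seminorm_diff_tendsto[OF q]) (rule tendsto_ident_at)
    then have "((\<lambda>y. f y - f x) \<longlongrightarrow> 0) (at x within UNIV)"
      by (rule Lim_null_comparison[rotated])
        (use le in \<open>simp add: linear_functionalD(3)[OF f, symmetric]\<close>)
    then show "(f \<longlongrightarrow> f x) (at x within UNIV)"
      by (simp add: LIM_zero_iff)
  qed
  then show ?thesis using f by (simp add: top_dual_def)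
qed

text \<open>A point outside the closure has a neighbourhood that misses \<open>M\<close> and is given by finitely many
  seminorms; in their sum, which is a continuous seminorm, the point has positive distance from \<open>M\<close>.\<close>
lemma separating_functional:
  assumes M: "subspace M" and "closure M \<noteq> UNIV"
  shows "\<exists>f\<in>top_dual smul. (\<exists>x. f x \<noteq> 0) \<and> (\<forall>m\<in>M. f m = 0)"
proof -
  obtain x0 where x0: "x0 \<in> - closure M" using assms(2) by blast
  obtain F e where F: "finite F" "F \<subseteq> \<Gamma>" and e: "0 < e"
    and sub: "{y. \<forall>p\<in>F. p (y - x0) < e} \<subseteq> - closure M"
    by (rule open_contains_seminorm_ball[OF open_Compl[OF closed_closure] x0])
  define q where "q = (\<lambda>x. \<Sum>p\<in>F. p x)"
  have snF: "seminorm smul p" if "p \<in> F" for p using that F seminorm_mem by blast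
  have q: "seminorm smul q"
    unfolding seminorm_def q_def
    by (auto intro!: sum_nonneg sum_mono
        simp: seminorm_nonneg[OF snF] seminorm_triangle[OF snF] seminorm_scale[OF snF]
          sum_distrib_left sum.distrib[symmetric])
  have q_cont: "continuous_on UNIV q"
    unfolding q_def by (intro continuous_on_sum continuous_mem) (use F in blast)
  have far: "e \<le> q (x0 - m)" if "m \<in> M" for m
  proof -
    have "m \<notin> {y. \<forall>p\<in>F. p (y - x0) < e}" using sub closure_subset that by blast
    then obtain p where p: "p \<in> F" "e \<le> p (m - x0)" by force
    have "p (x0 - m) \<le> q (x0 - m)" unfolding q_def
      using p(1) F(1) seminorm_nonneg[OF snF] by (intro member_le_sum) auto
    then show ?thesis using p(2) seminorm_minus_commute[OF snF[OF p(1)]] by simp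
  qed
  obtain f where f: "Vector_Spaces.linear smul (*) f" "\<And>x. cmod (f x) \<le> q x"
      "\<forall>m\<in>M. f m = 0" "e \<le> Re (f x0)"
    using hahn_banach_subspace[OF q M far] by blast
  have "f x0 \<noteq> 0" using f(4) e by auto
  then show ?thesis using dualI[OF f(1) q q_cont f(2)] f(3) by blast
qed

text \<open>The functionals in question are exactly those that annihilate the range of \<open>\<mu> - B\<close>. The range is
  assumed to be a subspace in place of linearity of \<open>B\<close> on \<open>D\<close>.\<close>
theorem residual_spectrum_iff_eigenfunctional:
  assumes M: "subspace ((\<lambda>x. smul \<mu> x - B x) ` D)"
  shows "\<mu> \<in> residual_spectrum smul D B \<longleftrightarrow>
         (\<exists>f\<in>top_dual smul. (\<exists>x. f x \<noteq> 0) \<and> (\<forall>x\<in>D. f (B x) = \<mu> * f x))"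
proof
  assume "\<mu> \<in> residual_spectrum smul D B"
  then obtain f where f: "f \<in> top_dual smul" "\<exists>x. f x \<noteq> 0"
      "\<And>x. x \<in> D \<Longrightarrow> f (smul \<mu> x - B x) = 0"
    using separating_functional[OF M] unfolding residual_spectrum_def by blast
  then show "\<exists>f\<in>top_dual smul. (\<exists>x. f x \<noteq> 0) \<and> (\<forall>x\<in>D. f (B x) = \<mu> * f x)"
    by (intro bexI[of _ f]) (simp_all add: dual_diff dual_scale)
next
  assume "\<exists>f\<in>top_dual smul. (\<exists>x. f x \<noteq> 0) \<and> (\<forall>x\<in>D. f (B x) = \<mu> * f x)"
  then obtain f x where f: "f \<in> top_dual smul" and x: "f x \<noteq> 0"
    and eq: "\<And>x. x \<in> D \<Longrightarrow> f (B x) = \<mu> * f x" by blast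
  have "closed (f -` {0})"
    by (rule closed_vimage[OF closed_singleton dual_continuous[OF f]])
  moreover have "(\<lambda>x. smul \<mu> x - B x) ` D \<subseteq> f -` {0}"
    using eq by (auto simp: dual_diff[OF f] dual_scale[OF f])
  ultimately have "closure ((\<lambda>x. smul \<mu> x - B x) ` D) \<subseteq> f -` {0}"
    by (rule closure_minimal[rotated])
  then show "\<mu> \<in> residual_spectrum smul D B" using x by (auto simp: residual_spectrum_def)
qed

end

section \<open>Scalar integrals along orbits\<close>

text \<open>Both sides equal the integral over \<open>[0, h + r]\<close> minus those over \<open>[0, h]\<close> and \<open>[0, r]\<close>. With \<open>h\<close> fixed and
  \<open>r\<close> small, this differentiates the integral of an orbit; if \<open>g\<close> has period \<open>h\<close>, the right-hand side
  vanishes and the integral over a period is translation invariant.\<close>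
lemma integral_translate_diff:
  fixes g :: "real \<Rightarrow> complex"
  assumes g: "continuous_on {0..} g" and h: "0 \<le> h" and r: "0 \<le> r"
  shows "integral {0..h} (\<lambda>s. g (s + r)) - integral {0..h} g =
         integral {0..r} (\<lambda>s. g (s + h) - g s)"
proof -
  have cont: "continuous_on {a..b} g" if "0 \<le> a" for a b
    using g by (rule continuous_on_subset) (use that in auto)
  have shift: "integral {0..a} (\<lambda>s. g (s + b)) = integral {b..a + b} g" if "0 \<le> b" for a b
    using integral_shift[of 0 b a g] cont[of b "a + b"] that by (simp add: o_def)
  have split: "integral {0..b} g + integral {b..a + b} g = integral {0..a + b} g"
    if "0 \<le> a" "0 \<le> b" for a b
    using that by (intro Henstock_Kurzweil_Integration.integral_combine integrable_continuous_interval cont) auto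
  have "integral {0..r} (\<lambda>s. g (s + h) - g s)
        = integral {0..r} (\<lambda>s. g (s + h)) - integral {0..r} g"
    using h by (intro integral_diff integrable_continuous_interval continuous_on_compose2[OF g] cont
        continuous_intros) auto
  also have "\<dots> = integral {h..h + r} g - integral {0..r} g"
    using shift[OF h, of r] by (simp add: add.commute)
  also have "\<dots> = (integral {0..h + r} g - integral {0..h} g) - integral {0..r} g"
    using split[OF r h] by (simp add: add.commute eq_diff_eq)
  also have "\<dots> = (integral {0..h + r} g - integral {0..r} g) - integral {0..h} g"
    by simp
  also have "integral {0..h + r} g - integral {0..r} g = integral {0..h} (\<lambda>s. g (s + r))"
    using split[OF h r] shift[OF r, of h] by (simp add: diff_eq_eq add.commute)
  finally show ?thesis by simp
qed

text \<open>The integral equation makes \<open>\<phi>\<close> differentiable with \<open>\<phi>' = \<mu> \<phi>\<close>, so \<open>exp (- s \<mu>) \<phi> s\<close> has derivative \<open>0\<close>.\<close>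
lemma exponential_if_integral_equation:
  fixes \<phi> :: "real \<Rightarrow> complex"
  assumes cont: "continuous_on {0..} \<phi>"
    and eq: "\<And>h. 0 \<le> h \<Longrightarrow> \<phi> h = \<phi> 0 + \<mu> * integral {0..h} \<phi>"
    and h: "0 \<le> h"
  shows "\<phi> h = exp (complex_of_real h * \<mu>) * \<phi> 0"
proof -
  have cont_h: "continuous_on {0..h} \<phi>" using cont by (rule continuous_on_subset) auto
  define \<psi> where "\<psi> = (\<lambda>s. exp (- (complex_of_real s * \<mu>)) * \<phi> s)"
  have "(\<psi> has_vector_derivative 0) (at s within {0..h})" if s: "s \<in> {0..h}" for s
  proof -
    have "((\<lambda>u. \<phi> 0 + \<mu> * integral {0..u} \<phi>) has_vector_derivative \<mu> * \<phi> s) (at s within {0..h})"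
      using integral_has_vector_derivative[OF cont_h s] by (auto intro!: derivative_eq_intros)
    then have \<phi>': "(\<phi> has_vector_derivative \<mu> * \<phi> s) (at s within {0..h})"
    proof (rule has_vector_derivative_transform[OF s, rotated])
      fix u assume "u \<in> {0..h}"
      then show "\<phi> u = \<phi> 0 + \<mu> * integral {0..u} \<phi>" by (intro eq) simp
    qed
    have "((\<lambda>s. exp (- (complex_of_real s * \<mu>))) has_vector_derivative
            - \<mu> * exp (- (complex_of_real s * \<mu>))) (at s within {0..h})"
      by (rule has_vector_derivative_real_field) (auto intro!: derivative_eq_intros)
    from has_vector_derivative_mult[OF this \<phi>'] show ?thesis
      unfolding \<psi>_def by (simp add: algebra_simps)
  qed
  then obtain c where "\<And>s. s \<in> {0..h} \<Longrightarrow> \<psi> s = c"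
    using has_vector_derivative_zero_constant[of "{0..h}" \<psi>] by (auto simp: convex_real_interval)
  then have "\<psi> h = \<psi> 0" using h by auto
  then have "exp (complex_of_real h * \<mu>) * \<psi> h = exp (complex_of_real h * \<mu>) * \<phi> 0"
    by (simp add: \<psi>_def)
  then show ?thesis by (simp add: \<psi>_def mult.assoc[symmetric] exp_add[symmetric])
qed

text \<open>The error depends on \<open>\<phi>\<close> only through its oscillation \<open>e\<close> on intervals of the mesh size. For
  \<open>\<phi> s = f (u s)\<close> it is therefore uniform in all functionals \<open>f\<close> bounded by a given seminorm.\<close>
lemma riemann_sum_error:
  fixes \<phi> :: "real \<Rightarrow> complex"
  assumes cont: "continuous_on {0..h} \<phi>" and h: "0 \<le> h" and n: "0 < n"
    and osc: "\<And>s r. s \<in> {0..h} \<Longrightarrow> r \<in> {0..h} \<Longrightarrow> \<bar>s - r\<bar> \<le> h / real n \<Longrightarrow> cmod (\<phi> s - \<phi> r) \<le> e"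
  shows "cmod ((\<Sum>k<n. complex_of_real (h / real n) * \<phi> (real k * (h / real n))) - integral {0..h} \<phi>) \<le> h * e"
proof -
  define d where "d = h / real n"
  have d: "0 \<le> d" "real n * d = h" using h n by (simp_all add: d_def)
  have "cmod ((\<Sum>k<m. complex_of_real d * \<phi> (real k * d)) - integral {0..real m * d} \<phi>) \<le> (real m * d) * e"
    if "m \<le> n" for m
    using that
  proof (induction m)
    case 0
    then show ?case by simp
  next
    case (Suc m)
    define a where "a = real m * d"
    have a: "0 \<le> a" "a + d \<le> h" "real (Suc m) * d = a + d"
      using d mult_right_mono[of "real (Suc m)" "real n" d] Suc.prems
      by (simp_all add: a_def algebra_simps)
    have cont_sub: "continuous_on {x..y} \<phi>" if "0 \<le> x" "y \<le> h" for x y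
      using cont by (rule continuous_on_subset) (use that in auto)
    have "integral {0..a} \<phi> + integral {a..a + d} \<phi> = integral {0..a + d} \<phi>"
      using a d by (intro Henstock_Kurzweil_Integration.integral_combine integrable_continuous_interval cont_sub) auto
    moreover have "cmod (integral {a..a + d} (\<lambda>s. \<phi> a - \<phi> s)) \<le> e * (a + d - a)"
      using a d by (intro integral_bound continuous_intros cont_sub osc) (auto simp: d_def)
    moreover have "integral {a..a + d} (\<lambda>s. \<phi> a - \<phi> s) = complex_of_real d * \<phi> a - integral {a..a + d} \<phi>"
      using a d by (subst integral_diff) (auto intro!: integrable_continuous_interval cont_sub simp: scaleR_conv_of_real)
    moreover have "cmod ((\<Sum>k<m. complex_of_real d * \<phi> (real k * d)) - integral {0..a} \<phi>) \<le> a * e"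
      using Suc unfolding a_def by simp
    moreover have "(\<Sum>k<Suc m. complex_of_real d * \<phi> (real k * d)) - integral {0..a + d} \<phi>
        = ((\<Sum>k<m. complex_of_real d * \<phi> (real k * d)) - integral {0..a} \<phi>)
          + integral {a..a + d} (\<lambda>s. \<phi> a - \<phi> s)"
      unfolding calculation(3) calculation(1)[symmetric] by (simp add: a_def)
    ultimately have "cmod ((\<Sum>k<Suc m. complex_of_real d * \<phi> (real k * d)) - integral {0..a + d} \<phi>)
        \<le> a * e + e * (a + d - a)"
      using norm_triangle_mono by metis
    also have "\<dots> = (a + d) * e" by (simp add: algebra_simps)
    finally show ?case unfolding a(3) .
  qed
  from this[of n] show ?thesis unfolding d(2) by (simp add: d_def)
qed

section \<open>Fourier coefficients of continuous functions on an interval\<close>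

lemma integral_reflect_interval:
  fixes f :: "real \<Rightarrow> 'b::euclidean_space"
  shows "integral {0..t} (\<lambda>s. f (t - s)) = integral {0..t} f"
proof -
  have "integral {- 0..- (- t)} (\<lambda>s. f (t + - s)) = integral {- t..0} (\<lambda>u. f (t + u))"
    by (rule Henstock_Kurzweil_Integration.integral_reflect_real)
  also have "\<dots> = integral {- t + t..0 + t} f"
    using integral_shift_Icc_real[of "-t" 0 f t] by (simp only: o_def)
  finally show ?thesis
    by (simp only: minus_zero minus_minus add_uminus_conv_diff left_minus add_0)
qed

definition fourier_mode :: "real \<Rightarrow> int \<Rightarrow> real \<Rightarrow> complex" where
  "fourier_mode t n s = cis (2 * pi / t * real_of_int n * s)"

lemma continuous_on_fourier_mode [continuous_intros]: "continuous_on S (fourier_mode t n)"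
  unfolding fourier_mode_def by (intro continuous_intros)

lemma cos_mult_fourier_mode:
  "complex_of_real (cos (2 * pi / t * s)) * fourier_mode t n s =
   (fourier_mode t (n + 1) s + fourier_mode t (n - 1) s) / 2"
proof -
  have up: "fourier_mode t (n + 1) s = cis (2 * pi / t * s) * fourier_mode t n s"
    and down: "fourier_mode t (n - 1) s = cis (- (2 * pi / t * s)) * fourier_mode t n s"
    by (simp_all add: fourier_mode_def cis_mult add_divide_distrib diff_divide_distrib algebra_simps)
  have "complex_of_real (cos (2 * pi / t * s)) = (cis (2 * pi / t * s) + cis (- (2 * pi / t * s))) / 2"
    by (simp add: complex_eq_iff)
  then show ?thesis unfolding up down by (simp only: distrib_right times_divide_eq_left)
qed

definition fourier_null :: "real \<Rightarrow> (real \<Rightarrow> complex) \<Rightarrow> bool" where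
  "fourier_null t \<psi> \<longleftrightarrow>
     continuous_on {0..t} \<psi> \<and> (\<forall>n. integral {0..t} (\<lambda>s. fourier_mode t n s * \<psi> s) = 0)"

text \<open>Multiplication by these functions preserves vanishing of all Fourier coefficients. This condition is
  evidently closed under products, so they form an algebra without a computation with powers of
  cosines. The symmetry \<open>s \<mapsto> t - s\<close> halves the interval on which a function has to be approximated.\<close>
definition symmetric_multiplier :: "real \<Rightarrow> (real \<Rightarrow> real) \<Rightarrow> bool" where
  "symmetric_multiplier t g \<longleftrightarrow>
     continuous_on {0..t} g \<and> (\<forall>s. g (t - s) = g s) \<and>
     (\<forall>\<psi>. fourier_null t \<psi> \<longrightarrow> fourier_null t (\<lambda>s. complex_of_real (g s) * \<psi> s))"

lemma symmetric_multiplier_const: "symmetric_multiplier t (\<lambda>_. c)"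
  unfolding symmetric_multiplier_def
proof (intro conjI allI impI)
  fix \<psi> assume \<psi>: "fourier_null t \<psi>"
  have "integral {0..t} (\<lambda>s. fourier_mode t n s * (complex_of_real c * \<psi> s))
      = complex_of_real c * integral {0..t} (\<lambda>s. fourier_mode t n s * \<psi> s)" for n
    by (simp only: mult.left_commute[of "fourier_mode t n _"] integral_mult_right)
  then show "fourier_null t (\<lambda>s. complex_of_real c * \<psi> s)"
    using \<psi> by (auto simp: fourier_null_def intro!: continuous_intros)
qed simp_all

lemma symmetric_multiplier_add:
  assumes f: "symmetric_multiplier t f" and g: "symmetric_multiplier t g"
  shows "symmetric_multiplier t (\<lambda>s. f s + g s)"
  unfolding symmetric_multiplier_def
proof (intro conjI allI impI)
  show "continuous_on {0..t} (\<lambda>s. f s + g s)"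
    using f g by (auto simp: symmetric_multiplier_def intro!: continuous_intros)
  show "f (t - s) + g (t - s) = f s + g s" for s
    using f g by (simp add: symmetric_multiplier_def)
  fix \<psi> assume "fourier_null t \<psi>"
  then have "fourier_null t (\<lambda>s. complex_of_real (f s) * \<psi> s)"
    and "fourier_null t (\<lambda>s. complex_of_real (g s) * \<psi> s)"
    using f g by (auto simp: symmetric_multiplier_def)
  then show "fourier_null t (\<lambda>s. complex_of_real (f s + g s) * \<psi> s)"
    unfolding fourier_null_def of_real_add distrib_left distrib_right
    by (subst integral_add) (auto intro!: continuous_intros integrable_continuous_interval)
qed

lemma symmetric_multiplier_mult:
  assumes f: "symmetric_multiplier t f" and g: "symmetric_multiplier t g"
  shows "symmetric_multiplier t (\<lambda>s. f s * g s)"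
  unfolding symmetric_multiplier_def
proof (intro conjI allI impI)
  show "continuous_on {0..t} (\<lambda>s. f s * g s)"
    using f g by (auto simp: symmetric_multiplier_def intro!: continuous_intros)
  show "f (t - s) * g (t - s) = f s * g s" for s
    using f g by (simp add: symmetric_multiplier_def)
  fix \<psi> assume "fourier_null t \<psi>"
  then have "fourier_null t (\<lambda>s. complex_of_real (g s) * \<psi> s)"
    using g by (simp add: symmetric_multiplier_def)
  then have "fourier_null t (\<lambda>s. complex_of_real (f s) * (complex_of_real (g s) * \<psi> s))"
    using f unfolding symmetric_multiplier_def by blast
  then show "fourier_null t (\<lambda>s. complex_of_real (f s * g s) * \<psi> s)"
    by (simp add: mult.assoc)
qed

text \<open>Multiplication by the cosine averages two neighbouring Fourier coefficients.\<close>
lemma symmetric_multiplier_cos: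
  assumes "t \<noteq> 0"
  shows "symmetric_multiplier t (\<lambda>s. cos (2 * pi / t * s))"
  unfolding symmetric_multiplier_def
proof (intro conjI allI impI)
  show "continuous_on {0..t} (\<lambda>s. cos (2 * pi / t * s))"
    by (intro continuous_intros) (use assms in auto)
  show "cos (2 * pi / t * (t - s)) = cos (2 * pi / t * s)" for s
    using assms cos_diff[of "2 * pi" "2 * pi / t * s"] by (simp add: right_diff_distrib diff_divide_distrib)
  fix \<psi> assume \<psi>: "fourier_null t \<psi>"
  have int: "(\<lambda>s. fourier_mode t n s * \<psi> s) integrable_on {0..t}" for n
    using \<psi> by (auto simp: fourier_null_def intro!: integrable_continuous_interval continuous_intros)
  have "integral {0..t} (\<lambda>s. fourier_mode t n s * (complex_of_real (cos (2 * pi / t * s)) * \<psi> s)) = 0" for n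
  proof -
    have "fourier_mode t n s * (complex_of_real (cos (2 * pi / t * s)) * \<psi> s)
        = (1/2) * (fourier_mode t (n + 1) s * \<psi> s + fourier_mode t (n - 1) s * \<psi> s)" for s
    proof -
      have "fourier_mode t n s * (complex_of_real (cos (2 * pi / t * s)) * \<psi> s)
          = (complex_of_real (cos (2 * pi / t * s)) * fourier_mode t n s) * \<psi> s"
        by (simp only: mult_ac)
      then show ?thesis unfolding cos_mult_fourier_mode
        by (simp only: times_divide_eq_left mult_1_left distrib_right)
    qed
    moreover have "integral {0..t} (\<lambda>s. fourier_mode t (n + 1) s * \<psi> s + fourier_mode t (n - 1) s * \<psi> s) = 0"
      using \<psi> int by (subst integral_add) (simp_all add: fourier_null_def)
    ultimately show ?thesis by (simp only: integral_mult_right mult_zero_right)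
  qed
  then show "fourier_null t (\<lambda>s. complex_of_real (cos (2 * pi / t * s)) * \<psi> s)"
    using \<psi> assms by (auto simp: fourier_null_def intro!: continuous_intros)
qed

text \<open>The cosine is injective on \<open>[0, t/2]\<close>, so the Stone--Weierstrass theorem applies there; symmetry
  carries the estimate over to \<open>[0, t]\<close>.\<close>
lemma symmetric_multipliers_dense:
  assumes t: "0 < t" and w: "continuous_on {0..t} w" and sym: "\<And>s. w (t - s) = w s" and e: "0 < e"
  shows "\<exists>g. symmetric_multiplier t g \<and> (\<forall>s\<in>{0..t}. \<bar>w s - g s\<bar> < e)"
proof -
  have "\<exists>g. symmetric_multiplier t g \<and> (\<forall>s\<in>{0..t/2}. \<bar>w s - g s\<bar> < e)"
  proof (rule Stone_Weierstrass_HOL)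
    show "compact {0..t/2}" by simp
    show "continuous_on {0..t/2} w" by (rule continuous_on_subset[OF w]) (use t in auto)
    show "continuous_on {0..t/2} f" if "symmetric_multiplier t f" for f
    proof (rule continuous_on_subset)
      show "continuous_on {0..t} f" using that by (simp add: symmetric_multiplier_def)
    qed (use t in auto)
    show "\<exists>f. symmetric_multiplier t f \<and> f x \<noteq> f y" if xy: "x \<in> {0..t/2} \<and> y \<in> {0..t/2} \<and> x \<noteq> y" for x y
    proof (intro exI conjI)
      show "symmetric_multiplier t (\<lambda>s. cos (2 * pi / t * s))"
        using t by (intro symmetric_multiplier_cos) simp
      have "2 * pi / t * s \<le> pi" if "s \<in> {0..t/2}" for s
        using that t pi_gt_zero by (auto simp: field_simps)
      then show "cos (2 * pi / t * x) \<noteq> cos (2 * pi / t * y)"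
        using xy t cos_inj_pi[of "2 * pi / t * x" "2 * pi / t * y"] by auto
    qed
  qed (use e in \<open>auto intro: symmetric_multiplier_const symmetric_multiplier_add symmetric_multiplier_mult\<close>)
  then obtain g where g: "symmetric_multiplier t g" "\<And>s. s \<in> {0..t/2} \<Longrightarrow> \<bar>w s - g s\<bar> < e" by blast
  have "\<bar>w s - g s\<bar> < e" if s: "s \<in> {0..t}" for s
  proof (cases "s \<le> t/2")
    case False
    then have "\<bar>w (t - s) - g (t - s)\<bar> < e" using s by (intro g) auto
    then show ?thesis using sym g(1) by (simp add: symmetric_multiplier_def)
  qed (use g s in auto)
  then show ?thesis using g(1) by blast
qed

text \<open>Approximating \<open>w\<close> by multipliers shows that the integral of \<open>w * w\<close> is \<open>0\<close>.\<close>
lemma symmetric_annihilated_eq_0: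
  fixes w :: "real \<Rightarrow> real"
  assumes t: "0 < t" and w: "continuous_on {0..t} w" and sym: "\<And>s. w (t - s) = w s"
    and ann: "\<And>g. symmetric_multiplier t g \<Longrightarrow> integral {0..t} (\<lambda>s. g s * w s) = 0"
    and s: "s \<in> {0..t}"
  shows "w s = 0"
proof -
  define I where "I = integral {0..t} (\<lambda>s. w s * w s)"
  define K where "K = integral {0..t} (\<lambda>s. \<bar>w s\<bar>)"
  have K: "0 \<le> K" unfolding K_def
    by (intro integral_nonneg integrable_continuous_interval continuous_intros w) auto
  have bound: "I \<le> e * K" if e: "0 < e" for e
  proof -
    obtain g where g: "symmetric_multiplier t g" "\<And>s. s \<in> {0..t} \<Longrightarrow> \<bar>w s - g s\<bar> < e"
      using symmetric_multipliers_dense[OF t w sym e] by blast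
    have gc: "continuous_on {0..t} g" using g(1) by (simp add: symmetric_multiplier_def)
    have "I = integral {0..t} (\<lambda>s. w s * w s) - integral {0..t} (\<lambda>s. g s * w s)"
      using ann[OF g(1)] by (simp add: I_def)
    also have "\<dots> = integral {0..t} (\<lambda>s. w s * w s - g s * w s)"
      by (intro integral_diff[symmetric] integrable_continuous_interval continuous_intros w gc)
    also have "\<dots> \<le> integral {0..t} (\<lambda>s. e * \<bar>w s\<bar>)"
    proof (rule integral_le)
      fix s assume "s \<in> {0..t}"
      then have "\<bar>w s - g s\<bar> * \<bar>w s\<bar> \<le> e * \<bar>w s\<bar>" using g(2)[of s] by (intro mult_right_mono) auto
      then show "w s * w s - g s * w s \<le> e * \<bar>w s\<bar>"
        using abs_ge_self[of "(w s - g s) * w s"] unfolding abs_mult by (simp add: left_diff_distrib)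
    qed (intro integrable_continuous_interval continuous_intros w gc)+
    also have "\<dots> = e * K" by (simp add: K_def)
    finally show ?thesis .
  qed
  have "I \<le> 0"
  proof (rule field_le_epsilon)
    fix e :: real assume "0 < e"
    then have "I \<le> e / (K + 1) * K" using K by (intro bound) simp
    also have "\<dots> \<le> e" using K \<open>0 < e\<close> by (simp add: field_simps)
    finally show "I \<le> 0 + e" by simp
  qed
  moreover have "0 \<le> I" unfolding I_def
    by (intro integral_nonneg integrable_continuous_interval continuous_intros w) auto
  ultimately have "I = 0" by simp
  moreover have "continuous_on {0..t} (\<lambda>s. w s * w s)" by (intro continuous_intros w)
  ultimately have "\<forall>s\<in>{0..t}. w s * w s = 0"
    using integral_eq_0_iff[OF _ t] unfolding I_def by force
  then show ?thesis using s by simp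
qed

text \<open>Multipliers \<open>g\<close> are symmetric and annihilate \<open>\<phi>\<close>, hence also its symmetrization \<open>\<phi> s + \<phi> (t - s)\<close>, which therefore
  vanishes. For a periodic function the value at \<open>s = 0\<close> is \<open>2 * \<phi> 0\<close>.\<close>
theorem fourier_null_endpoints:
  assumes t: "0 < t" and \<phi>: "fourier_null t \<phi>"
  shows "\<phi> 0 + \<phi> t = 0"
proof -
  have cont: "continuous_on {0..t} \<phi>" using \<phi> by (simp add: fourier_null_def)
  have cont': "continuous_on {0..t} (\<lambda>s. \<phi> (t - s))"
    by (rule continuous_on_compose2[OF cont]) (auto intro!: continuous_intros)
  define v where "v = (\<lambda>s. \<phi> s + \<phi> (t - s))"
  have v: "continuous_on {0..t} v" unfolding v_def by (intro continuous_intros cont cont')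
  have ann: "((\<lambda>s. complex_of_real (g s) * v s) has_integral 0) {0..t}"
    if g: "symmetric_multiplier t g" for g
  proof -
    have gc: "continuous_on {0..t} (\<lambda>s. complex_of_real (g s))"
      using g by (auto simp: symmetric_multiplier_def intro!: continuous_intros)
    have "fourier_null t (\<lambda>s. complex_of_real (g s) * \<phi> s)"
      using g \<phi> by (simp add: symmetric_multiplier_def)
    then have "integral {0..t} (\<lambda>s. fourier_mode t 0 s * (complex_of_real (g s) * \<phi> s)) = 0"
      unfolding fourier_null_def by blast
    then have 1: "integral {0..t} (\<lambda>s. complex_of_real (g s) * \<phi> s) = 0"
      by (simp add: fourier_mode_def)
    have 2: "integral {0..t} (\<lambda>s. complex_of_real (g s) * \<phi> (t - s)) = 0"
      using 1 g integral_reflect_interval[of t "\<lambda>s. complex_of_real (g s) * \<phi> s"]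
      by (simp add: symmetric_multiplier_def)
    have "integral {0..t} (\<lambda>s. complex_of_real (g s) * v s) = 0"
      unfolding v_def distrib_left using 1 2
      by (subst integral_add) (auto intro!: integrable_continuous_interval continuous_intros gc cont cont')
    moreover have "(\<lambda>s. complex_of_real (g s) * v s) integrable_on {0..t}"
      by (intro integrable_continuous_interval continuous_intros gc v)
    ultimately show ?thesis by (metis integrable_integral)
  qed
  have "Re (v 0) = 0"
  proof (rule symmetric_annihilated_eq_0[OF t, of "\<lambda>s. Re (v s)"])
    show "integral {0..t} (\<lambda>s. g s * Re (v s)) = 0" if "symmetric_multiplier t g" for g
      using has_integral_Re[OF ann[OF that]] by (simp add: integral_unique)
  qed (use t in \<open>auto intro!: continuous_intros cont cont' simp: v_def\<close>)
  moreover have "Im (v 0) = 0"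
  proof (rule symmetric_annihilated_eq_0[OF t, of "\<lambda>s. Im (v s)"])
    show "integral {0..t} (\<lambda>s. g s * Im (v s)) = 0" if "symmetric_multiplier t g" for g
      using has_integral_Im[OF ann[OF that]] by (simp add: integral_unique)
  qed (use t in \<open>auto intro!: continuous_intros cont cont' simp: v_def\<close>)
  ultimately have "v 0 = 0" by (simp add: complex_eq_iff)
  then show ?thesis by (simp add: v_def)
qed

section \<open>Weak integrals of continuous curves\<close>

context lcs
begin

lemma dual_continuous_on:
  assumes f: "f \<in> top_dual smul" and u: "continuous_on S u"
  shows "continuous_on S (\<lambda>s. f (u s))"
  by (rule continuous_on_compose2[OF dual_continuous[OF f] u]) simp

lemma dual_if_dominated:
  assumes "Vector_Spaces.linear smul (*) f" "p \<in> \<Gamma>" "\<And>x. cmod (f x) \<le> p x"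
  shows "f \<in> top_dual smul"
  using assms by (intro dualI seminorm_mem continuous_mem)

text \<open>Through such an \<open>f\<close>, estimates in \<open>X\<close> reduce to estimates of scalar functions that are uniform in the functional.\<close>
lemma norming_functional_dual:
  assumes p: "p \<in> \<Gamma>"
  obtains f where "f \<in> top_dual smul" "\<And>y. cmod (f y) \<le> p y" "p x \<le> cmod (f x)"
  using norming_functional[OF seminorm_mem[OF p], of x] dual_if_dominated[OF _ p] by blast

text \<open>The function \<open>p (u s - u r)\<close> is uniformly continuous on the square and vanishes on the diagonal.\<close>
lemma seminorm_uniformly_continuous:
  assumes p: "p \<in> \<Gamma>" and u: "continuous_on {0..h::real} u" and e: "0 < e"
  shows "\<exists>d>0. \<forall>s\<in>{0..h}. \<forall>r\<in>{0..h}. \<bar>s - r\<bar> < d \<longrightarrow> p (u s - u r) < e"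
proof -
  define S where "S = {0..h} \<times> {0..h}"
  have "compact S" unfolding S_def by (intro compact_Times) auto
  moreover have "continuous_on S (\<lambda>x. p (u (fst x) - u (snd x)))"
    by (intro continuous_on_compose2[OF continuous_mem[OF p]] continuous_on_compose2[OF u]
        continuous_intros) (auto simp: S_def)
  ultimately have "uniformly_continuous_on S (\<lambda>x. p (u (fst x) - u (snd x)))"
    by (rule compact_uniformly_continuous[rotated])
  then obtain d where d: "0 < d" "\<And>x y. x \<in> S \<Longrightarrow> y \<in> S \<Longrightarrow> dist y x < d \<Longrightarrow>
      dist (p (u (fst y) - u (snd y))) (p (u (fst x) - u (snd x))) < e"
    unfolding uniformly_continuous_on_def using e by blast
  have "p (u s - u r) < e" if "s \<in> {0..h}" "r \<in> {0..h}" "\<bar>s - r\<bar> < d" for s r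
    using d(2)[of "(r, r)" "(s, r)"] that
    by (simp add: S_def dist_Pair_Pair dist_real_def seminorm_zero[OF seminorm_mem[OF p]])
  then show ?thesis using d(1) by blast
qed

text \<open>The Riemann sums form a Cauchy sequence: their difference is measured by a functional \<open>f\<close> with
  \<open>\<bar>f\<bar> \<le> p\<close>, and for all such \<open>f\<close> both sums are uniformly close to the same scalar integral, so different
  partitions need not be compared.\<close>
theorem weak_integral_exists:
  fixes h :: real
  assumes complete: "seq_complete_on UNIV \<Gamma>" and h: "0 \<le> h" and u: "continuous_on {0..h} u"
  shows "\<exists>y. \<forall>f\<in>top_dual smul. f y = integral {0..h} (\<lambda>s. f (u s))"
proof -
  define R where "R = (\<lambda>n. \<Sum>k<Suc n. smul (complex_of_real (h / real (Suc n))) (u (real k * (h / real (Suc n)))))"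
  have f_R: "f (R n) = (\<Sum>k<Suc n. complex_of_real (h / real (Suc n)) * f (u (real k * (h / real (Suc n)))))"
    if "f \<in> top_dual smul" for f n
    unfolding R_def by (simp only: dual_sum[OF that] dual_scale[OF that])
  have approx: "\<exists>N. \<forall>n\<ge>N. \<forall>f\<in>top_dual smul. (\<forall>x. cmod (f x) \<le> p x) \<longrightarrow>
      cmod (f (R n) - integral {0..h} (\<lambda>s. f (u s))) < e"
    if p: "p \<in> \<Gamma>" and e: "0 < e" for p e
  proof -
    define e' where "e' = e / (h + 1)"
    have e': "0 < e'" "h * e' < e" using e h by (simp_all add: e'_def field_simps)
    obtain d where d: "0 < d"
      "\<And>s r. s \<in> {0..h} \<Longrightarrow> r \<in> {0..h} \<Longrightarrow> \<bar>s - r\<bar> < d \<Longrightarrow> p (u s - u r) < e'"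
      using seminorm_uniformly_continuous[OF p u e'(1)] by blast
    have lim: "(\<lambda>n. h / real (Suc n)) \<longlonglongrightarrow> 0" by (rule LIMSEQ_Suc[OF lim_const_over_n])
    obtain N where N: "\<And>n. N \<le> n \<Longrightarrow> h / real (Suc n) < d"
      using order_tendstoD(2)[OF lim d(1)] unfolding eventually_sequentially by blast
    have "cmod (f (R n) - integral {0..h} (\<lambda>s. f (u s))) < e"
      if n: "N \<le> n" and f: "f \<in> top_dual smul" and le: "\<And>x. cmod (f x) \<le> p x" for n f
    proof -
      have "cmod (f (R n) - integral {0..h} (\<lambda>s. f (u s))) \<le> h * e'"
        unfolding f_R[OF f]
      proof (rule riemann_sum_error[OF dual_continuous_on[OF f u] h])
        fix s r assume sr: "s \<in> {0..h}" "r \<in> {0..h}" "\<bar>s - r\<bar> \<le> h / real (Suc n)"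
        have "cmod (f (u s) - f (u r)) \<le> p (u s - u r)"
          using le[of "u s - u r"] by (simp add: dual_diff[OF f])
        also have "\<dots> \<le> e'" using d(2)[OF sr(1,2)] sr(3) N[OF n] by simp
        finally show "cmod (f (u s) - f (u r)) \<le> e'" .
      qed simp
      then show ?thesis using e'(2) by simp
    qed
    then show ?thesis by blast
  qed
  have "\<exists>N. \<forall>m\<ge>N. \<forall>n\<ge>N. p (R m - R n) < e" if p: "p \<in> \<Gamma>" and e: "0 < e" for p and e :: real
  proof -
    obtain N where N: "\<And>n f. N \<le> n \<Longrightarrow> f \<in> top_dual smul \<Longrightarrow> \<forall>x. cmod (f x) \<le> p x \<Longrightarrow>
        cmod (f (R n) - integral {0..h} (\<lambda>s. f (u s))) < e / 2"
      using approx[OF p, of "e / 2"] e by auto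
    have "p (R m - R n) < e" if "N \<le> m" "N \<le> n" for m n
    proof -
      obtain f where f: "f \<in> top_dual smul" "\<And>x. cmod (f x) \<le> p x" "p (R m - R n) \<le> cmod (f (R m - R n))"
        using norming_functional_dual[OF p, of "R m - R n"] by blast
      have "cmod (f (R m) - integral {0..h} (\<lambda>s. f (u s))) < e / 2"
        by (rule N[OF that(1) f(1)]) (simp add: f(2))
      moreover have "cmod (f (R n) - integral {0..h} (\<lambda>s. f (u s))) < e / 2"
        by (rule N[OF that(2) f(1)]) (simp add: f(2))
      ultimately have "cmod (f (R m) - f (R n)) < e"
        unfolding dist_norm[symmetric] by (rule dist_triangle_half_l)
      then show ?thesis using f(3) by (simp add: dual_diff[OF f(1)])
    qed
    then show ?thesis by blast
  qed
  then obtain y where y: "\<And>p. p \<in> \<Gamma> \<Longrightarrow> (\<lambda>n. p (R n - y)) \<longlonglongrightarrow> 0"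
    using complete unfolding seq_complete_on_def by (metis UNIV_I subset_UNIV)
  have "f y = integral {0..h} (\<lambda>s. f (u s))" if f: "f \<in> top_dual smul" for f
  proof -
    have lim: "(\<lambda>n. f (R n)) \<longlonglongrightarrow> f y"
      by (rule dual_tendsto[OF f], rule tendsto_seminormsI, rule y)
    obtain p C where p: "p \<in> \<Gamma>" and C: "0 \<le> C" "\<And>x. cmod (f x) \<le> C * p x"
      using dual_bounded[OF f] by blast
    \<comment> \<open>The approximation is uniform over functionals bounded by \<open>p\<close> itself, so \<open>f\<close> is rescaled;
      \<open>C + 1\<close> avoids division by zero.\<close>
    define c where "c = complex_of_real (1 / (C + 1))"
    define g where "g = (\<lambda>x. c * f x)"
    have cmod_c: "cmod c = 1 / (C + 1)" unfolding c_def norm_of_real using C(1) by simp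
    have c: "c \<noteq> 0" unfolding c_def of_real_eq_0_iff using C(1) by simp
    have g_le: "cmod (g x) \<le> p x" for x
    proof -
      have "cmod (f x) \<le> (C + 1) * p x"
        using C(2)[of x] seminorm_nonneg[OF seminorm_mem[OF p], of x] by (simp add: distrib_right)
      then show ?thesis using C(1) by (simp add: g_def cmod_c norm_mult field_simps)
    qed
    have g: "g \<in> top_dual smul"
      by (rule dual_if_dominated[OF linear_functionalI p g_le])
        (simp_all add: g_def dual_add[OF f] dual_scale[OF f] distrib_left)
    have "(\<lambda>n. g (R n)) \<longlonglongrightarrow> integral {0..h} (\<lambda>s. g (u s))"
    proof (rule LIMSEQ_I)
      fix e :: real assume "0 < e"
      then show "\<exists>N. \<forall>n\<ge>N. norm (g (R n) - integral {0..h} (\<lambda>s. g (u s))) < e"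
        using approx[OF p] g g_le by blast
    qed
    moreover have "(\<lambda>n. g (R n)) \<longlonglongrightarrow> g y"
      unfolding g_def by (intro tendsto_intros lim)
    ultimately have "g y = integral {0..h} (\<lambda>s. g (u s))"
      by (rule LIMSEQ_unique[rotated])
    then show ?thesis using c by (simp add: g_def)
  qed
  then show ?thesis by blast
qed

end

section \<open>Semigroups and their generators\<close>

locale lc_semigroup = lcs smul \<Gamma>
  for smul :: "complex \<Rightarrow> 'a::{topological_ab_group_add,t2_space} \<Rightarrow> 'a" and \<Gamma> :: "('a \<Rightarrow> real) set" +
  fixes T :: "real \<Rightarrow> 'a \<Rightarrow> 'a"
  assumes semigroup: "operator_semigroup smul T"
    and strong_cont: "strongly_continuous T"
    and equicontinuous: "locally_equicontinuous \<Gamma> T"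
begin

abbreviation "D \<equiv> generator_domain smul T"
abbreviation "A \<equiv> generator smul T"

abbreviation diff_quotient :: "'a \<Rightarrow> real \<Rightarrow> 'a" where
  "diff_quotient x r \<equiv> smul (complex_of_real (1 / r)) (T r x - x)"

lemma T_zero: "T 0 x = x"
  using semigroup by (simp add: operator_semigroup_def)

lemma T_add: "0 \<le> t \<Longrightarrow> 0 \<le> s \<Longrightarrow> T (t + s) x = T t (T s x)"
  using semigroup by (simp add: operator_semigroup_def)

lemma T_continuous: "0 \<le> t \<Longrightarrow> continuous_on UNIV (T t)"
  and T_linear: "0 \<le> t \<Longrightarrow> Vector_Spaces.linear smul smul (T t)"
  using semigroup by (simp_all add: operator_semigroup_def continuous_linear_operators_def)

lemma
  assumes "0 \<le> t"
  shows T_plus: "T t (x + y) = T t x + T t y"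
    and T_diff: "T t (x - y) = T t x - T t y"
    and T_scale: "T t (smul c x) = smul c (T t x)"
proof -
  interpret T: Vector_Spaces.linear smul smul "T t" by (rule T_linear) fact
  show "T t (x + y) = T t x + T t y" "T t (x - y) = T t x - T t y" "T t (smul c x) = smul c (T t x)"
    by (rule T.add T.diff T.scale)+
qed

lemma orbit_continuous: "continuous_on {0..} (\<lambda>s. T s x)"
  using strong_cont by (simp add: strongly_continuous_def)

lemma dual_orbit_continuous:
  assumes f: "f \<in> top_dual smul"
  shows "continuous_on {0..} (\<lambda>s. f (T s x))"
  by (rule dual_continuous_on[OF f orbit_continuous])

lemma dual_orbit_continuous_Icc:
  assumes f: "f \<in> top_dual smul"
  shows "continuous_on {0..h} (\<lambda>s. f (T s x))"
  using dual_orbit_continuous[OF f] by (rule continuous_on_subset) auto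

lemma dual_T:
  assumes f: "f \<in> top_dual smul" and t: "0 \<le> t"
  shows "(\<lambda>x. f (T t x)) \<in> top_dual smul"
proof -
  have "continuous_on UNIV (\<lambda>x. f (T t x))"
    by (rule dual_continuous_on[OF f T_continuous[OF t]])
  moreover have "Vector_Spaces.linear smul (*) (\<lambda>x. f (T t x))"
    by (rule linear_functionalI) (simp_all add: T_plus[OF t] T_scale[OF t] dual_add[OF f] dual_scale[OF f])
  ultimately show ?thesis by (simp add: top_dual_def)
qed

lemma generator_tendsto:
  assumes "x \<in> D"
  shows "(diff_quotient x \<longlongrightarrow> A x) (at_right 0)"
proof -
  obtain y where y: "(diff_quotient x \<longlongrightarrow> y) (at_right 0)"
    using assms by (auto simp: generator_domain_def)
  then have "A x = y" unfolding generator_def by (rule tendsto_Lim[rotated]) simp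
  then show ?thesis using y by simp
qed

lemma generatorI:
  assumes "(diff_quotient x \<longlongrightarrow> y) (at_right 0)"
  shows "x \<in> D" and "A x = y"
  using assms unfolding generator_def by (auto simp: generator_domain_def intro!: tendsto_Lim)

lemma smul_tendsto:
  assumes "(u \<longlongrightarrow> l) F"
  shows "((\<lambda>i. smul c (u i)) \<longlongrightarrow> smul c l) F"
proof (rule tendsto_seminormsI)
  fix p assume p: "p \<in> \<Gamma>"
  have "((\<lambda>i. cmod c * p (u i - l)) \<longlongrightarrow> cmod c * 0) F"
    by (intro tendsto_intros continuous_seminorm_diff_tendsto[OF seminorm_mem[OF p] continuous_mem[OF p] assms])
  then show "((\<lambda>i. p (smul c (u i) - smul c l)) \<longlongrightarrow> 0) F"
    by (simp add: scale_right_diff_distrib[symmetric] seminorm_scale[OF seminorm_mem[OF p]])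
qed

lemma generator_add:
  assumes "x \<in> D" "y \<in> D"
  shows "x + y \<in> D" and "A (x + y) = A x + A y"
proof -
  have "((\<lambda>r. diff_quotient x r + diff_quotient y r) \<longlongrightarrow> A x + A y) (at_right 0)"
    by (intro tendsto_add generator_tendsto assms)
  moreover have "eventually (\<lambda>r. diff_quotient x r + diff_quotient y r = diff_quotient (x + y) r) (at_right 0)"
    using eventually_at_right_less[of 0]
    by eventually_elim (simp add: T_plus scale_right_distrib[symmetric])
  ultimately have "(diff_quotient (x + y) \<longlongrightarrow> A x + A y) (at_right 0)"
    by (rule Lim_transform_eventually)
  then show "x + y \<in> D" and "A (x + y) = A x + A y" by (rule generatorI)+
qed

lemma generator_scale:
  assumes "x \<in> D"
  shows "smul c x \<in> D" and "A (smul c x) = smul c (A x)"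
proof -
  have "((\<lambda>r. smul c (diff_quotient x r)) \<longlongrightarrow> smul c (A x)) (at_right 0)"
    by (intro smul_tendsto generator_tendsto assms)
  moreover have "eventually (\<lambda>r. smul c (diff_quotient x r) = diff_quotient (smul c x) r) (at_right 0)"
    using eventually_at_right_less[of 0]
    by eventually_elim (simp add: T_scale scale_right_diff_distrib mult.commute)
  ultimately have "(diff_quotient (smul c x) \<longlongrightarrow> smul c (A x)) (at_right 0)"
    by (rule Lim_transform_eventually)
  then show "smul c x \<in> D" and "A (smul c x) = smul c (A x)" by (rule generatorI)+
qed

lemma generator_zero: "0 \<in> D" "A 0 = 0"
proof -
  have T0: "T r 0 = 0" if "0 \<le> r" for r using T_diff[OF that, of 0 0] by simp
  have "eventually (\<lambda>r. 0 = diff_quotient 0 r) (at_right 0)"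
    using eventually_at_right_less[of 0] by eventually_elim (simp add: T0)
  then have "(diff_quotient 0 \<longlongrightarrow> 0) (at_right 0)"
    by (rule Lim_transform_eventually[OF tendsto_const])
  then show "0 \<in> D" "A 0 = 0" by (rule generatorI)+
qed

lemma subspace_range_generator: "subspace ((\<lambda>x. smul \<mu> x - A x) ` D)"
proof (rule subspaceI)
  show "0 \<in> (\<lambda>x. smul \<mu> x - A x) ` D"
    using generator_zero by (intro image_eqI[of _ _ 0]) simp_all
  fix v w assume "v \<in> (\<lambda>x. smul \<mu> x - A x) ` D" "w \<in> (\<lambda>x. smul \<mu> x - A x) ` D"
  then obtain x y where "x \<in> D" "y \<in> D" "v = smul \<mu> x - A x" "w = smul \<mu> y - A y" by blast
  then show "v + w \<in> (\<lambda>x. smul \<mu> x - A x) ` D"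
    by (intro image_eqI[of _ _ "x + y"]) (simp_all add: generator_add scale_right_distrib)
next
  fix c v assume "v \<in> (\<lambda>x. smul \<mu> x - A x) ` D"
  then obtain x where "x \<in> D" "v = smul \<mu> x - A x" by blast
  then show "smul c v \<in> (\<lambda>x. smul \<mu> x - A x) ` D"
    by (intro image_eqI[of _ _ "smul c x"])
      (simp_all add: generator_scale scale_right_diff_distrib mult.commute)
qed

lemma subspace_range_T:
  assumes t: "0 \<le> t"
  shows "subspace (range (\<lambda>x. smul \<mu> x - T t x))"
proof (rule subspaceI)
  show "0 \<in> range (\<lambda>x. smul \<mu> x - T t x)"
    using T_diff[OF t, of 0 0] by (intro image_eqI[of _ _ 0]) simp_all
  fix v w assume "v \<in> range (\<lambda>x. smul \<mu> x - T t x)" "w \<in> range (\<lambda>x. smul \<mu> x - T t x)"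
  then obtain x y where "v = smul \<mu> x - T t x" "w = smul \<mu> y - T t y" by blast
  then show "v + w \<in> range (\<lambda>x. smul \<mu> x - T t x)"
    by (intro image_eqI[of _ _ "x + y"]) (simp_all add: T_plus[OF t] scale_right_distrib)
next
  fix c v assume "v \<in> range (\<lambda>x. smul \<mu> x - T t x)"
  then obtain x where "v = smul \<mu> x - T t x" by blast
  then show "smul c v \<in> range (\<lambda>x. smul \<mu> x - T t x)"
    by (intro image_eqI[of _ _ "smul c x"])
      (simp_all add: T_scale[OF t] scale_right_diff_distrib mult.commute)
qed

text \<open>For every functional \<open>f\<close>, the value of \<open>f\<close> at the difference quotient of \<open>y\<close> minus \<open>z = T h x - x\<close> is the mean of
  \<open>f (T s z - z)\<close> over \<open>[0, r]\<close> (\<open>integral_translate_diff\<close>). By norming functionals its seminorms are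
  bounded by those of \<open>T s z - z\<close>, \<open>s \<le> r\<close>, which tend to \<open>0\<close> with \<open>r\<close>.\<close>
lemma orbit_integral_generator:
  assumes h: "0 \<le> h" and y: "\<And>f. f \<in> top_dual smul \<Longrightarrow> f y = integral {0..h} (\<lambda>s. f (T s x))"
  shows "y \<in> D" and "A y = T h x - x"
proof -
  define z where "z = T h x - x"
  have weak: "f (diff_quotient y r - z) = complex_of_real (1 / r) * integral {0..r} (\<lambda>s. f (T s z - z))"
    if f: "f \<in> top_dual smul" and r: "0 < r" for f r
  proof -
    have "f (T r y) = integral {0..h} (\<lambda>s. f (T (s + r) x))"
      unfolding y[OF dual_T[OF f less_imp_le[OF r]]]
      using T_add[of r] r by (intro integral_cong) (simp add: add.commute)
    then have "f (T r y - y) = integral {0..r} (\<lambda>s. f (T (s + h) x) - f (T s x))"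
      using integral_translate_diff[OF dual_orbit_continuous[OF f] h, of r x] r y[OF f]
      by (simp add: dual_diff[OF f])
    also have "\<dots> = integral {0..r} (\<lambda>s. f (T s z))"
      using h by (intro integral_cong) (simp add: T_add T_diff z_def dual_diff[OF f])
    also have "\<dots> = integral {0..r} (\<lambda>s. f (T s z - z)) + complex_of_real r * f z"
      using r by (simp add: dual_diff[OF f] scaleR_conv_of_real
          integral_diff[OF integrable_continuous_interval[OF dual_orbit_continuous_Icc[OF f]] integrable_const_ivl])
    finally have increment: "f (T r y - y) = integral {0..r} (\<lambda>s. f (T s z - z)) + complex_of_real r * f z" .
    have "f (diff_quotient y r - z) = complex_of_real (1 / r) * f (T r y - y) - f z"
      by (subst dual_diff[OF f]) (simp only: dual_scale[OF f])
    then show ?thesis unfolding increment using r by (simp add: field_simps)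
  qed
  have "(diff_quotient y \<longlongrightarrow> z) (at_right 0)"
  proof (rule tendsto_seminormsI)
    fix p assume p: "p \<in> \<Gamma>"
    show "((\<lambda>r. p (diff_quotient y r - z)) \<longlongrightarrow> 0) (at_right 0)"
    proof (rule tendstoI)
      fix e :: real assume e: "0 < e"
      have "continuous_on {0..1} (\<lambda>s. T s z)" by (rule continuous_on_subset[OF orbit_continuous]) auto
      from seminorm_uniformly_continuous[OF p this, of "e / 2"] e
      obtain d where d: "0 < d" "\<And>s r. s \<in> {0..1} \<Longrightarrow> r \<in> {0..1} \<Longrightarrow> \<bar>s - r\<bar> < d \<Longrightarrow> p (T s z - T r z) < e / 2"
        by auto
      have small: "p (diff_quotient y r - z) < e" if r: "0 < r" "r < min d 1" for r
      proof -
        obtain f where f: "f \<in> top_dual smul" "\<And>x. cmod (f x) \<le> p x"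
            "p (diff_quotient y r - z) \<le> cmod (f (diff_quotient y r - z))"
          using norming_functional_dual[OF p, of "diff_quotient y r - z"] by blast
        have "cmod (integral {0..r} (\<lambda>s. f (T s z - z))) \<le> (e / 2) * (r - 0)"
        proof (rule integral_bound)
          show "continuous_on {0..r} (\<lambda>s. f (T s z - z))"
            unfolding dual_diff[OF f(1)]
            by (intro continuous_intros dual_orbit_continuous_Icc f)
          fix s assume "s \<in> {0..r}"
          then have "p (T s z - T 0 z) < e / 2" using r by (intro d(2)) auto
          then show "cmod (f (T s z - z)) \<le> e / 2"
            using f(2)[of "T s z - z"] by (simp add: T_zero)
        qed (use r in simp)
        then have "cmod (f (diff_quotient y r - z)) \<le> e / 2"
          unfolding weak[OF f(1) r(1)] using r(1) by (simp add: norm_mult norm_divide field_simps)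
        then show ?thesis using f(3) e by simp
      qed
      have "eventually (\<lambda>r. 0 < r \<and> r < min d 1) (at_right 0)"
        using eventually_at_right_real[of 0 "min d 1"] d(1) by simp
      then show "eventually (\<lambda>r. dist (p (diff_quotient y r - z)) 0 < e) (at_right 0)"
        by eventually_elim
          (use small seminorm_nonneg[OF seminorm_mem[OF p]] in \<open>simp add: dist_real_def\<close>)
    qed
  qed
  then show "y \<in> D" and "A y = T h x - x" unfolding z_def by (rule generatorI)+
qed


section \<open>Eigenfunctionals of the generator and of the semigroup\<close>

text \<open>The eigenvalue equation is applied to \<open>y\<close>, the integral of the orbit of \<open>x\<close> over \<open>[0, h]\<close>, for which \<open>A y = T h x - x\<close>;
  so the conclusion holds for every \<open>x\<close> and not only on the domain.\<close>
lemma eigenfunctional_orbit: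
  assumes complete: "seq_complete_on UNIV \<Gamma>" and f: "f \<in> top_dual smul"
    and eig: "\<And>x. x \<in> D \<Longrightarrow> f (A x) = \<mu> * f x" and h: "0 \<le> h"
  shows "f (T h x) = exp (complex_of_real h * \<mu>) * f x"
proof -
  have "f (T h x) = f (T 0 x) + \<mu> * integral {0..h} (\<lambda>s. f (T s x))" if h: "0 \<le> h" for h
  proof -
    have "continuous_on {0..h} (\<lambda>s. T s x)" by (rule continuous_on_subset[OF orbit_continuous]) auto
    from weak_integral_exists[OF complete h this]
    obtain y where y: "\<And>g. g \<in> top_dual smul \<Longrightarrow> g y = integral {0..h} (\<lambda>s. g (T s x))" by blast
    have "f (A y) = \<mu> * f y" by (rule eig[OF orbit_integral_generator(1)[OF h y]])
    moreover have "A y = T h x - x" by (rule orbit_integral_generator(2)[OF h y])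
    ultimately have "f (T h x) - f x = \<mu> * integral {0..h} (\<lambda>s. f (T s x))"
      using y[OF f] by (simp add: dual_diff[OF f])
    then show ?thesis by (simp add: T_zero diff_eq_eq add.commute)
  qed
  from exponential_if_integral_equation[OF dual_orbit_continuous[OF f] this h]
  show ?thesis by (simp add: T_zero)
qed

lemma eigenfunctional_generator:
  assumes f: "f \<in> top_dual smul"
    and orbit: "\<And>r x. 0 \<le> r \<Longrightarrow> f (T r x) = exp (complex_of_real r * \<mu>) * f x"
    and x: "x \<in> D"
  shows "f (A x) = \<mu> * f x"
proof -
  have "((\<lambda>z. exp (z * \<mu>)) has_field_derivative \<mu>) (at 0)"
    by (auto intro!: derivative_eq_intros)
  then have "((\<lambda>z. (exp (z * \<mu>) - 1) / z) \<longlongrightarrow> \<mu>) (at 0)"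
    by (simp add: DERIV_def)
  moreover have "filterlim complex_of_real (at 0) (at_right 0)"
    unfolding filterlim_at
    using tendsto_of_real[OF tendsto_ident_at[of 0 "{0<..}"], where 'a = complex]
    by (auto simp: eventually_at_filter)
  ultimately have "((\<lambda>r. (exp (complex_of_real r * \<mu>) - 1) / complex_of_real r) \<longlongrightarrow> \<mu>) (at_right 0)"
    by (rule filterlim_compose)
  then have "((\<lambda>r. (exp (complex_of_real r * \<mu>) - 1) / complex_of_real r * f x) \<longlongrightarrow> \<mu> * f x) (at_right 0)"
    by (intro tendsto_intros)
  moreover have "eventually (\<lambda>r. (exp (complex_of_real r * \<mu>) - 1) / complex_of_real r * f x = f (diff_quotient x r))
      (at_right 0)"
    using eventually_at_right_less[of 0]
    by eventually_elim (simp only: dual_scale[OF f] dual_diff[OF f] orbit less_imp_le, simp add: field_simps)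
  ultimately have "((\<lambda>r. f (diff_quotient x r)) \<longlongrightarrow> \<mu> * f x) (at_right 0)"
    by (rule Lim_transform_eventually)
  moreover have "((\<lambda>r. f (diff_quotient x r)) \<longlongrightarrow> f (A x)) (at_right 0)"
    by (rule dual_tendsto[OF f generator_tendsto[OF x]])
  ultimately show ?thesis by (intro tendsto_unique[of "at_right 0"]) auto
qed

lemma dual_locally_equicontinuous:
  assumes f: "f \<in> top_dual smul" and t: "0 \<le> t"
  obtains p C where "p \<in> \<Gamma>" "0 \<le> C" "\<And>s x. s \<in> {0..t} \<Longrightarrow> cmod (f (T s x)) \<le> C * p x"
proof -
  obtain q B where q: "q \<in> \<Gamma>" "0 \<le> B" "\<And>x. cmod (f x) \<le> B * q x"
    using dual_bounded[OF f] by blast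
  obtain p C where p: "p \<in> \<Gamma>" "0 \<le> C" "\<And>s x. s \<in> {0..t} \<Longrightarrow> q (T s x) \<le> C * p x"
    using equicontinuous q(1) t unfolding locally_equicontinuous_def by blast
  show thesis
  proof (rule that[of p "B * C"])
    fix s x assume "s \<in> {0..t}"
    then have "B * q (T s x) \<le> B * (C * p x)" using q(2) p(3) by (intro mult_left_mono)
    then show "cmod (f (T s x)) \<le> B * C * p x" using q(3)[of "T s x"] by simp
  qed (use p q in simp_all)
qed

lemma orbit_transform_dual:
  assumes f: "f \<in> top_dual smul" and t: "0 \<le> t"
  shows "(\<lambda>x. integral {0..t} (\<lambda>s. exp (- (complex_of_real s * \<mu>)) * f (T s x))) \<in> top_dual smul"
    (is "?g \<in> _")
proof -
  define w where "w = (\<lambda>s. exp (- (complex_of_real s * \<mu>)))"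
  have w: "continuous_on S w" for S unfolding w_def by (intro continuous_intros)
  have int: "(\<lambda>s. w s * f (T s x)) integrable_on {0..t}" for x
    by (intro integrable_continuous_interval continuous_intros w dual_orbit_continuous_Icc f)
  have "compact (w ` {0..t})" by (intro compact_continuous_image w) simp
  then obtain K where "\<forall>z\<in>w ` {0..t}. cmod z \<le> K"
    using compact_imp_bounded bounded_iff by metis
  then have K: "\<And>s. s \<in> {0..t} \<Longrightarrow> cmod (w s) \<le> K" by blast
  have K0: "0 \<le> K" using t by (intro order_trans[OF norm_ge_zero K[of 0]]) simp
  obtain p C where p: "p \<in> \<Gamma>" and C: "0 \<le> C" "\<And>s x. s \<in> {0..t} \<Longrightarrow> cmod (f (T s x)) \<le> C * p x"
    using dual_locally_equicontinuous[OF f t] by blast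
  define q where "q = (\<lambda>x. (K * C * t) * p x)"
  have "(\<lambda>x. integral {0..t} (\<lambda>s. w s * f (T s x))) \<in> top_dual smul"
  proof (rule dualI)
    show "Vector_Spaces.linear smul (*) (\<lambda>x. integral {0..t} (\<lambda>s. w s * f (T s x)))"
    proof (rule linear_functionalI)
      fix x y
      have "integral {0..t} (\<lambda>s. w s * f (T s (x + y))) = integral {0..t} (\<lambda>s. w s * f (T s x) + w s * f (T s y))"
        by (intro integral_cong) (simp add: T_plus dual_add[OF f] distrib_left)
      then show "integral {0..t} (\<lambda>s. w s * f (T s (x + y)))
          = integral {0..t} (\<lambda>s. w s * f (T s x)) + integral {0..t} (\<lambda>s. w s * f (T s y))"
        by (simp add: integral_add[OF int int])
    next
      fix c x
      have "integral {0..t} (\<lambda>s. w s * f (T s (smul c x))) = integral {0..t} (\<lambda>s. c * (w s * f (T s x)))"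
        by (intro integral_cong) (simp add: T_scale dual_scale[OF f])
      then show "integral {0..t} (\<lambda>s. w s * f (T s (smul c x))) = c * integral {0..t} (\<lambda>s. w s * f (T s x))"
        by simp
    qed
    show "seminorm smul q"
      using K0 C(1) t seminorm_mem[OF p] mult_left_mono[of "p _" _ "K * C * t"]
      by (simp add: q_def seminorm_def distrib_left[symmetric])
    show "continuous_on UNIV q" unfolding q_def by (intro continuous_intros continuous_mem p)
    show "cmod (integral {0..t} (\<lambda>s. w s * f (T s x))) \<le> q x" for x
    proof -
      have "cmod (integral {0..t} (\<lambda>s. w s * f (T s x))) \<le> (K * (C * p x)) * (t - 0)"
      proof (rule integral_bound[OF t])
        show "continuous_on {0..t} (\<lambda>s. w s * f (T s x))"
          by (intro continuous_intros w dual_orbit_continuous_Icc f)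
        show "cmod (w s * f (T s x)) \<le> K * (C * p x)" if "s \<in> {0..t}" for s
          unfolding norm_mult using K[OF that] C(2)[OF that] K0 by (intro mult_mono) auto
      qed
      then show ?thesis by (simp add: q_def mult_ac)
    qed
  qed
  then show ?thesis by (simp add: w_def)
qed

text \<open>The integrand has period \<open>t\<close> by the assumption on \<open>f\<close>, so it may be translated by \<open>r\<close> under the integral.\<close>
lemma orbit_transform_eigenfunctional:
  assumes f: "f \<in> top_dual smul" and t: "0 \<le> t" and r: "0 \<le> r"
    and eig: "\<And>x. f (T t x) = exp (complex_of_real t * \<mu>) * f x"
  shows "integral {0..t} (\<lambda>s. exp (- (complex_of_real s * \<mu>)) * f (T s (T r x)))
       = exp (complex_of_real r * \<mu>) * integral {0..t} (\<lambda>s. exp (- (complex_of_real s * \<mu>)) * f (T s x))"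
proof -
  define \<psi> where "\<psi> = (\<lambda>s. exp (- (complex_of_real s * \<mu>)) * f (T s x))"
  have \<psi>: "continuous_on {0..} \<psi>"
    unfolding \<psi>_def by (intro continuous_intros dual_orbit_continuous f)
  have periodic: "\<psi> (s + t) = \<psi> s" if "0 \<le> s" for s
  proof -
    have "f (T (s + t) x) = exp (complex_of_real t * \<mu>) * f (T s x)"
      using T_add[OF t that, of x] eig by (simp add: add.commute)
    then show ?thesis
      by (simp add: \<psi>_def mult.assoc[symmetric] exp_add[symmetric] distrib_right)
  qed
  have "integral {0..r} (\<lambda>s. \<psi> (s + t) - \<psi> s) = integral {0..r} (\<lambda>s. 0)"
    by (intro integral_cong) (simp add: periodic)
  then have "integral {0..t} (\<lambda>s. \<psi> (s + r)) = integral {0..t} \<psi>"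
    using integral_translate_diff[OF \<psi> t r] by simp
  moreover have "integral {0..t} (\<lambda>s. exp (- (complex_of_real s * \<mu>)) * f (T s (T r x)))
      = integral {0..t} (\<lambda>s. exp (complex_of_real r * \<mu>) * \<psi> (s + r))"
    using r by (intro integral_cong)
      (simp add: \<psi>_def T_add mult.assoc[symmetric] exp_add[symmetric] distrib_right)
  ultimately show ?thesis by (simp add: \<psi>_def)
qed

text \<open>The solutions of \<open>exp (t \<mu>) = z\<close> are \<open>(Ln z - 2 \<pi> \<i> n) / t\<close>, and the corresponding integrals
  are, up to the factor \<open>t\<close>, the Fourier coefficients of \<open>\<phi> s = exp (- s * Ln z / t) * f (T s x)\<close>, which takes the value \<open>f x\<close> at
  both \<open>0\<close> and \<open>t\<close>.\<close>
lemma exists_nonzero_orbit_transform: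
  assumes f: "f \<in> top_dual smul" and t: "0 < t" and z: "z \<noteq> 0"
    and eig: "f (T t x) = z * f x" and x: "f x \<noteq> 0"
  shows "\<exists>\<mu>. exp (complex_of_real t * \<mu>) = z \<and>
             integral {0..t} (\<lambda>s. exp (- (complex_of_real s * \<mu>)) * f (T s x)) \<noteq> 0"
proof -
  define \<phi> where "\<phi> = (\<lambda>s. exp (- (complex_of_real s * (Ln z / complex_of_real t))) * f (T s x))"
  have \<phi>: "continuous_on {0..t} \<phi>"
    unfolding \<phi>_def by (intro continuous_intros dual_orbit_continuous_Icc f)
  have "\<phi> 0 + \<phi> t = 2 * f x"
    using t z by (simp add: \<phi>_def eig T_zero exp_minus)
  then have "\<not> fourier_null t \<phi>"
    using fourier_null_endpoints[OF t] x by force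
  then obtain n where n: "integral {0..t} (\<lambda>s. fourier_mode t n s * \<phi> s) \<noteq> 0"
    using \<phi> by (auto simp: fourier_null_def)
  define \<mu> where "\<mu> = Ln z / complex_of_real t - 2 * complex_of_real pi * of_int n * \<i> / complex_of_real t"
  have t\<mu>: "complex_of_real t * \<mu> = Ln z - 2 * of_int n * complex_of_real pi * \<i>"
    using t by (simp add: \<mu>_def right_diff_distrib mult_ac)
  have "exp (complex_of_real t * \<mu>) = z"
    unfolding t\<mu> exp_diff using z exp_integer_2pi[of "of_int n"] by simp
  moreover have "fourier_mode t n s * \<phi> s = exp (- (complex_of_real s * \<mu>)) * f (T s x)" for s
    by (simp add: fourier_mode_def cis_conv_exp \<phi>_def \<mu>_def mult.assoc[symmetric] exp_add[symmetric])
      (simp add: algebra_simps)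
  ultimately show ?thesis using n by auto
qed

section \<open>Spectral mapping for the residual spectrum\<close>

theorem spectral_mapping_pos:
  assumes complete: "seq_complete_on UNIV \<Gamma>" and t: "0 < t"
  shows "residual_spectrum smul UNIV (T t) - {0} =
         (\<lambda>\<mu>. exp (complex_of_real t * \<mu>)) ` residual_spectrum smul D A"
proof (intro equalityI subsetI)
  fix z assume "z \<in> residual_spectrum smul UNIV (T t) - {0}"
  then obtain f x where z: "z \<noteq> 0" and f: "f \<in> top_dual smul" and x: "f x \<noteq> 0"
    and eig: "\<And>x. f (T t x) = z * f x"
    using residual_spectrum_iff_eigenfunctional[OF subspace_range_T] t by auto
  obtain \<mu> where \<mu>: "exp (complex_of_real t * \<mu>) = z"
    and nz: "integral {0..t} (\<lambda>s. exp (- (complex_of_real s * \<mu>)) * f (T s x)) \<noteq> 0"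
    using exists_nonzero_orbit_transform[OF f t z eig x] by blast
  define g where "g = (\<lambda>x. integral {0..t} (\<lambda>s. exp (- (complex_of_real s * \<mu>)) * f (T s x)))"
  have g: "g \<in> top_dual smul" unfolding g_def using t by (intro orbit_transform_dual f) simp
  have "g (T r x) = exp (complex_of_real r * \<mu>) * g x" if "0 \<le> r" for r x
    unfolding g_def using t that eig \<mu> by (intro orbit_transform_eigenfunctional f) auto
  then have "\<forall>x\<in>D. g (A x) = \<mu> * g x"
    using eigenfunctional_generator[OF g] by blast
  moreover have "g x \<noteq> 0" using nz by (simp add: g_def)
  ultimately have "\<mu> \<in> residual_spectrum smul D A"
    using residual_spectrum_iff_eigenfunctional[OF subspace_range_generator] g by blast
  then show "z \<in> (\<lambda>\<mu>. exp (complex_of_real t * \<mu>)) ` residual_spectrum smul D A"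
    using \<mu> by blast
next
  fix z assume "z \<in> (\<lambda>\<mu>. exp (complex_of_real t * \<mu>)) ` residual_spectrum smul D A"
  then obtain \<mu> where \<mu>: "\<mu> \<in> residual_spectrum smul D A" and z: "z = exp (complex_of_real t * \<mu>)"
    by blast
  then obtain f where f: "f \<in> top_dual smul" "\<exists>x. f x \<noteq> 0"
    and eig: "\<And>x. x \<in> D \<Longrightarrow> f (A x) = \<mu> * f x"
    using residual_spectrum_iff_eigenfunctional[OF subspace_range_generator] by auto
  have "f (T t x) = z * f x" for x
    unfolding z using t by (intro eigenfunctional_orbit[OF complete f(1) eig]) simp_all
  then have "z \<in> residual_spectrum smul UNIV (T t)"
    using residual_spectrum_iff_eigenfunctional[OF subspace_range_T] f t by auto
  then show "z \<in> residual_spectrum smul UNIV (T t) - {0}" by (simp add: z)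
qed

lemma residual_spectrum_trivial_space:
  assumes trivial: "(UNIV :: 'a set) = {0}" and ne: "S \<noteq> {}"
  shows "residual_spectrum smul S B = {}"
proof -
  obtain x where x: "x \<in> S" using ne by blast
  have "z = smul \<mu> x - B x" for z \<mu>
    using trivial UNIV_I[of z] UNIV_I[of "smul \<mu> x - B x"] by (metis singletonD)
  then have "UNIV \<subseteq> (\<lambda>x. smul \<mu> x - B x) ` S" for \<mu>
    using x by (intro subsetI image_eqI)
  then have "closure ((\<lambda>x. smul \<mu> x - B x) ` S) = UNIV" for \<mu>
    using closure_subset by blast
  then show ?thesis by (simp add: residual_spectrum_def)
qed

lemma residual_spectrum_id:
  "residual_spectrum smul UNIV (T 0) = (if (UNIV :: 'a set) = {0} then {} else {1})"
proof (cases "(UNIV :: 'a set) = {0}")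
  case True
  show ?thesis
    unfolding if_P[OF True] by (rule residual_spectrum_trivial_space[OF True UNIV_not_empty])
next
  case False
  have "range (\<lambda>x. smul \<mu> x - T 0 x) = (if \<mu> = 1 then {0} else UNIV)" for \<mu>
  proof (cases "\<mu> = 1")
    case False
    have "y \<in> range (\<lambda>x. smul \<mu> x - T 0 x)" for y
      using False by (intro image_eqI[of _ _ "smul (1 / (\<mu> - 1)) y"])
        (simp_all add: T_zero scale_left_diff_distrib[symmetric] diff_divide_distrib[symmetric])
    then show ?thesis using False by auto
  qed (simp add: T_zero)
  then show ?thesis unfolding if_not_P[OF False] residual_spectrum_def using False by auto
qed

lemma spectral_mapping_zero:
  assumes "residual_spectrum smul D A \<noteq> {} \<or> (UNIV :: 'a set) = {0}"
  shows "residual_spectrum smul UNIV (T 0) - {0} =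
         (\<lambda>\<mu>. exp (complex_of_real 0 * \<mu>)) ` residual_spectrum smul D A"
proof (cases "(UNIV :: 'a set) = {0}")
  case True
  then have "residual_spectrum smul UNIV (T 0) = {}" "residual_spectrum smul D A = {}"
    using generator_zero(1) by (intro residual_spectrum_trivial_space; blast)+
  then show ?thesis by simp
next
  case False
  then show ?thesis using assms unfolding residual_spectrum_id if_not_P[OF False] by auto
qed

end

theorem theorem5p7:
  fixes smul :: "complex \<Rightarrow> 'a::{topological_ab_group_add,t2_space} \<Rightarrow> 'a"
    and \<Gamma> :: "('a \<Rightarrow> real) set"
    and T :: "real \<Rightarrow> 'a \<Rightarrow> 'a"
    and t :: real
  assumes "locally_convex_space smul \<Gamma>"
    and "seq_complete_on UNIV \<Gamma>"
    and "seq_complete_on (top_dual smul) (strong_dual_seminorms \<Gamma>)"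
    and "operator_semigroup smul T"
    and "strongly_continuous T"
    and "locally_equicontinuous \<Gamma> T"
    and "alg_resolvent_set smul (generator_domain smul T) (generator smul T) \<noteq> {}"
    and "t \<ge> 0"
    and "t = 0 \<Longrightarrow>
           residual_spectrum smul (generator_domain smul T) (generator smul T) \<noteq> {} \<or>
           (UNIV :: 'a set) = {0}"
  shows "residual_spectrum smul UNIV (T t) - {0} =
         (\<lambda>\<mu>. exp (complex_of_real t * \<mu>)) `
           residual_spectrum smul (generator_domain smul T) (generator smul T)"
proof -
  interpret vector_space smul
    using assms(1) by (simp add: locally_convex_space_def)
  interpret lc_semigroup smul \<Gamma> T
    using assms(1,4-6) by unfold_locales (simp_all add: locally_convex_space_def)
  show ?thesis
  proof (cases "t = 0")
    case True
    then show ?thesis using spectral_mapping_zero assms(9) by simp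
  next
    case False
    then show ?thesis using spectral_mapping_pos[OF assms(2)] assms(8) by simp
  qed
qed

end
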